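(* Let $a>0$ and let $q:\mathbb{R}\to\mathbb{R}$ be a real potential with $\int_{\mathbb{R}}|q(x)|^2e^{2a|x|}\,dx<\infty$. Let $\mathbb{D}_{a/3}=\{\lambda\in\mathbb{C}:|\lambda|<a/3\}$. Then for every $\lambda\in\mathbb{D}_{a/3}$ and $k\in\{0,1,2\}$ there exists a Jost solution $v_k(\lambda,x)$, i.e. a solution of $$iy'''(x)+q(x)y(x)=\lambda^3y(x)\quad(x\in\mathbb{R}),\qquad v_k(\lambda,x)-e^{i\lambda\zeta_kx}\to0\quad(x\to+\infty),$$ and it is given by $$v_k(\lambda,x)=e^{i\lambda\zeta_kx}+\int_x^\infty N(\lambda,x,t)q(t)e^{i\lambda\zeta_kt}\,dt .$$ The functions $v_0,v_1,v_2$ given by this formula are holomorphic in $\lambda$ in $\mathbb{D}_{a/3}$, and $$v_k(\lambda\zeta_1,x)=v_{k'}(\lambda,x),\qquad k'=(k+1)\bmod 3,\quad 0\le k\le2 .$$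
   Context: $\zeta_0=1$, $\zeta_1=\frac12(-1+i\sqrt3)$, $\zeta_2=\frac12(-1-i\sqrt3)$ are the cube roots of unity, and $s_2(z)=\frac13\sum_{k=0}^2\zeta_k^{-2}e^{\zeta_kz}$ ($z\in\mathbb{C}$). Put $K_1(\lambda,x,t)=\dfrac{s_2(i\lambda(x-t))}{(i\lambda)^2}$ for $\lambda\ne0$ and $K_1(0,x,t)=\frac{(x-t)^2}{2}$ (its limit as $\lambda\to0$). For $t\ge x$ define recursively $K_{n+1}(\lambda,x,t)=\int_x^tK_n(\lambda,x,s)q(s)K_1(\lambda,s,t)\,ds$ ($n\ge1$), and let $N(\lambda,x,t)=\sum_{n=1}^\infty(-i)^nK_n(\lambda,x,t)$ (a convergent series). *)

theory Defs
  imports "HOL-Analysis.Analysis" "HOL-Complex_Analysis.Complex_Analysis"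
begin

definition zeta :: "nat \<Rightarrow> complex" where
  "zeta k = (if k = 0 then 1
             else if k = 1 then (- 1 + \<i> * of_real (sqrt 3)) / 2
             else (- 1 - \<i> * of_real (sqrt 3)) / 2)"

definition s2 :: "complex \<Rightarrow> complex" where
  "s2 z = (1 / 3) * (\<Sum>k\<in>{0..2}. zeta k powi (- 2) * exp (zeta k * z))"

definition K1 :: "complex \<Rightarrow> real \<Rightarrow> real \<Rightarrow> complex" where
  "K1 l x t = (if l = 0 then of_real ((x - t)\<^sup>2 / 2)
               else s2 (\<i> * l * of_real (x - t)) / (\<i> * l)\<^sup>2)"

text \<open>
  The iterated kernels are indexed from 1; the value at index 0 is a dummy and is never used.
  Integrals are Lebesgue integrals, since the potential is only assumed Lebesgue measurable.
\<close>

fun K :: "(real \<Rightarrow> real) \<Rightarrow> nat \<Rightarrow> complex \<Rightarrow> real \<Rightarrow> real \<Rightarrow> complex" where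
  "K q 0 l x t = 0"
| "K q (Suc 0) l x t = K1 l x t"
| "K q (Suc (Suc n)) l x t =
     (LINT s:{x..t}|lebesgue. K q (Suc n) l x s * of_real (q s) * K1 l s t)"

definition N :: "(real \<Rightarrow> real) \<Rightarrow> complex \<Rightarrow> real \<Rightarrow> real \<Rightarrow> complex" where
  "N q l x t = (\<Sum>n. (- \<i>) ^ Suc n * K q (Suc n) l x t)"

definition jost_v :: "(real \<Rightarrow> real) \<Rightarrow> nat \<Rightarrow> complex \<Rightarrow> real \<Rightarrow> complex" where
  "jost_v q k l x = exp (\<i> * l * zeta k * of_real x) +
     (LINT t:{x..}|lebesgue. N q l x t * of_real (q t) * exp (\<i> * l * zeta k * of_real t))"

text \<open>
  All series and integrals in the formula for \<open>jost_v\<close> exist. This has to be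
  said separately because \<open>suminf\<close> and the Bochner integral are total functions.
\<close>

definition jost_formula_converges :: "(real \<Rightarrow> real) \<Rightarrow> nat \<Rightarrow> complex \<Rightarrow> bool" where
  "jost_formula_converges q k l \<longleftrightarrow>
     (\<forall>x t n. x \<le> t \<and> n \<ge> 1 \<longrightarrow>
        set_integrable lebesgue {x..t} (\<lambda>s. K q n l x s * of_real (q s) * K1 l s t)) \<and>
     (\<forall>x t. x \<le> t \<longrightarrow> summable (\<lambda>n. (- \<i>) ^ Suc n * K q (Suc n) l x t)) \<and>
     (\<forall>x. set_integrable lebesgue {x..}
        (\<lambda>t. N q l x t * of_real (q t) * exp (\<i> * l * zeta k * of_real t)))"

definition abs_cont_on_interval :: "(real \<Rightarrow> complex) \<Rightarrow> real \<Rightarrow> real \<Rightarrow> bool" where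
  "abs_cont_on_interval f a b \<longleftrightarrow>
     (\<forall>e>0. \<exists>d>0. \<forall>(n::nat) u v.
        (\<forall>i<n. a \<le> u i \<and> u i \<le> v i \<and> v i \<le> b) \<and>
        disjoint_family_on (\<lambda>i. {u i<..<v i}) {..<n} \<and>
        (\<Sum>i<n. v i - u i) < d
        \<longrightarrow> (\<Sum>i<n. norm (f (v i) - f (u i))) < e)"

definition locally_abs_cont :: "(real \<Rightarrow> complex) \<Rightarrow> bool" where
  "locally_abs_cont f \<longleftrightarrow> (\<forall>a b. abs_cont_on_interval f a b)"

text \<open>
  Since the potential is only locally square integrable, solutions of
  \<open>i y''' + q y = \<lambda>\<^sup>3 y\<close> are meant in the Caratheodory sense: \<open>y''\<close> exists everywhere and is
  locally absolutely continuous, and the equation holds almost everywhere.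
\<close>

definition is_solution :: "(real \<Rightarrow> real) \<Rightarrow> complex \<Rightarrow> (real \<Rightarrow> complex) \<Rightarrow> bool" where
  "is_solution q l y \<longleftrightarrow>
     (\<exists>y' y''.
        (\<forall>x. (y has_vector_derivative y' x) (at x)) \<and>
        (\<forall>x. (y' has_vector_derivative y'' x) (at x)) \<and>
        locally_abs_cont y'' \<and>
        (AE x in lebesgue. \<exists>w. (y'' has_vector_derivative w) (at x) \<and>
            \<i> * w + of_real (q x) * y x = l ^ 3 * y x))"

definition is_jost_solution ::
    "(real \<Rightarrow> real) \<Rightarrow> nat \<Rightarrow> complex \<Rightarrow> (real \<Rightarrow> complex) \<Rightarrow> bool" where
  "is_jost_solution q k l y \<longleftrightarrow>
     is_solution q l y \<and>
     ((\<lambda>x. y x - exp (\<i> * l * zeta k * of_real x)) \<longlongrightarrow> 0) at_top"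

end

theory Submission
  imports Defs
begin

text \<open>For \<open>\<bar>\<lambda>\<bar> < d < a/3\<close> the kernel satisfies \<open>\<bar>K\<^sub>1(\<lambda>,x,t)\<bar> \<le> C exp (d \<bar>x - t\<bar>)\<close>, and by Cauchy-Schwarz
  \<open>q(t) exp (2 d \<bar>t\<bar>)\<close> is integrable. Let \<open>T f(x)\<close> be the integral of \<open>K\<^sub>1(\<lambda>,x,t) q(t) f(t)\<close> over
  \<open>t \<ge> x\<close>. By Fubini the kernel \<open>K\<^sub>n\<close> represents \<open>T\<^sup>n\<close>, so the formula for \<open>v\<^sub>k\<close> is the Neumann series
  of \<open>v = e - i T v\<close>, where \<open>e\<close> is the plane wave, and it converges geometrically, locally uniformly
  in \<open>\<lambda>\<close>; this gives holomorphy. As a function \<open>G\<close> of \<open>z = x - t\<close> the kernel vanishes to second order at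
  \<open>0\<close> and satisfies \<open>d\<^sup>3G/dz\<^sup>3 = (i \<lambda>)\<^sup>3 G\<close>, so \<open>T v\<close> can be differentiated twice under the integral sign,
  and the third derivative produces the term \<open>q v\<close> almost everywhere by Lebesgue's differentiation theorem.
  The symmetry holds because \<open>K\<^sub>1(\<lambda> \<zeta>\<^sub>1,x,t) = K\<^sub>1(\<lambda>,x,t)\<close>.\<close>

section \<open>Tail integrals and absolute continuity\<close>

text \<open>No smallness of \<open>q\<close> is assumed, so \<open>T 0\<close> need not be a
  contraction. The kernel bounds therefore carry the weight
  \<open>exp (4 * C * (Q t - Q x))\<close>, with \<open>Q\<close> the primitive of
  \<open>\<bar>q\<bar>\<close>. Under this weight every iteration gains a factor 1/2, and since
  \<open>Q\<close> is bounded the weight costs only the constant \<open>M\<close>. Three rates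
  occur. \<open>d0\<close> bounds the modulus of the spectral parameter. The larger \<open>d\<close>
  also absorbs the factors |z| and |z|^2 that arise because the kernel estimates must stay uniform
  through the spectral value 0. The weight on \<open>q\<close> has rate 2 d because the growth of
  the kernel and the growth of the function it acts on are multiplied; d < a/3 makes 2 d < a. Only
  the second derivative is delicate: the second derivative of the kernel equals 1 at z = 0, so
  cutting it off there creates a jump. Splitting off this 1 leaves a convolution that is
  differentiable everywhere and a plain tail integral, and it is for the latter that absolute
  continuity and Lebesgue differentiation are proved first.\<close>

lemma set_integral_tail_diff:
  fixes g :: "real \<Rightarrow> complex"
  assumes g: "integrable lborel g" and "x \<le> y"
  shows "(LINT t:{x..}|lborel. g t) - (LINT t:{y..}|lborel. g t) = integral {x..y} g"
proof -
  have *: "set_integrable lborel A g" if "A \<in> sets borel" for A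
    using g that by (auto simp: set_integrable_def intro: integrable_mult_indicator)
  have "integral ({x..y} \<union> {y..}) g = integral {x..y} g + integral {y..} g"
  proof (rule Henstock_Kurzweil_Integration.integral_Un)
    have "{x..y} \<inter> {y..} = {y}" using assms by auto
    then show "negligible ({x..y} \<inter> {y..})" by simp
  qed (use *[THEN set_borel_integral_eq_integral(1)] in auto)
  moreover have "{x..y} \<union> {y..} = {x..}" using assms by auto
  ultimately show ?thesis
    using *[THEN set_borel_integral_eq_integral(2)] by simp
qed

text \<open>The differentiation theorem is used for averages over intervals to the right of a point.
  Averages to the left come from applying it to the reflected function at -x, so the exceptional set
  is \<open>N1\<close> together with the reflection of \<open>N2\<close>.\<close>

lemma AE_tail_integral_has_vector_derivative:
  fixes g :: "real \<Rightarrow> complex"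
  assumes g: "integrable lborel g"
  shows "AE x in lebesgue. ((\<lambda>x. LINT t:{x..}|lborel. g t) has_vector_derivative - g x) (at x)"
proof -
  let ?F = "\<lambda>x. LINT t:{x..}|lborel. g t"
  have g': "integrable lborel (\<lambda>t. g (- t))"
    using g lborel_integrable_real_affine[of g "-1" 0] by simp
  have int: "f integrable_on cbox a b" if "integrable lborel f" for f :: "real \<Rightarrow> complex" and a b :: real
    using that by (intro set_borel_integral_eq_integral(1)) (auto simp: set_integrable_def intro: integrable_mult_indicator)
  obtain N1 where N1: "negligible N1" "\<And>x e. \<lbrakk>x \<notin> N1; 0 < e\<rbrakk> \<Longrightarrow>
      \<exists>d>0. \<forall>h. 0 < h \<and> h < d \<longrightarrow> norm (integral (cbox x (x + h *\<^sub>R One)) g /\<^sub>R h ^ DIM(real) - g x) < e"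
    using integrable_ccontinuous_explicit[OF int[OF g]] by metis
  obtain N2 where N2: "negligible N2" "\<And>x e. \<lbrakk>x \<notin> N2; 0 < e\<rbrakk> \<Longrightarrow>
      \<exists>d>0. \<forall>h. 0 < h \<and> h < d \<longrightarrow> norm (integral (cbox x (x + h *\<^sub>R One)) (\<lambda>t. g (- t)) /\<^sub>R h ^ DIM(real) - g (- x)) < e"
    using integrable_ccontinuous_explicit[OF int[OF g']] by metis
  have scale: "norm (I - h *\<^sub>R c) \<le> e * h" if "norm (I /\<^sub>R h - c) < e" "h > 0" for I c :: complex and h e :: real
  proof -
    have "I - h *\<^sub>R c = h *\<^sub>R (I /\<^sub>R h - c)" using that by (simp add: scaleR_diff_right)
    also have "norm \<dots> = h * norm (I /\<^sub>R h - c)" using that by simp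
    finally show ?thesis using that by (simp add: mult.commute)
  qed
  have der: "(?F has_vector_derivative - g x) (at x)" if x: "x \<notin> N1 \<union> uminus ` N2" for x
    unfolding has_vector_derivative_def has_derivative_at_alt
  proof (intro conjI allI impI)
    show "bounded_linear (\<lambda>h. h *\<^sub>R - g x)" by (rule bounded_linear_scaleR_left)
    fix e :: real assume e: "0 < e"
    obtain d1 where d1: "d1 > 0" "\<And>h. 0 < h \<Longrightarrow> h < d1 \<Longrightarrow> norm (integral {x..x + h} g /\<^sub>R h - g x) < e"
      using N1(2)[of x e] x e by auto
    have "- x \<notin> N2" using x by (metis UnCI add.inverse_inverse imageI)
    then obtain d2 where d2: "d2 > 0" "\<And>h. 0 < h \<Longrightarrow> h < d2 \<Longrightarrow> norm (integral {-x..-x + h} (\<lambda>t. g (- t)) /\<^sub>R h - g x) < e"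
      using N2(2)[of "-x" e] e by auto
    show "\<exists>d>0. \<forall>y. norm (y - x) < d \<longrightarrow> norm (?F y - ?F x - (y - x) *\<^sub>R - g x) \<le> e * norm (y - x)"
    proof (intro exI conjI allI impI)
      show "min d1 d2 > 0" using d1 d2 by simp
      fix y assume y: "norm (y - x) < min d1 d2"
      consider "y = x" | "y > x" | "y < x" by linarith
      then show "norm (?F y - ?F x - (y - x) *\<^sub>R - g x) \<le> e * norm (y - x)"
      proof cases
        case 1 then show ?thesis by simp
      next
        case 2
        have "norm (integral {x..y} g - (y - x) *\<^sub>R g x) \<le> e * (y - x)"
          using d1(2)[of "y - x"] y 2 by (intro scale) auto
        moreover have "?F y - ?F x - (y - x) *\<^sub>R - g x = - (integral {x..y} g - (y - x) *\<^sub>R g x)"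
          using set_integral_tail_diff[OF g, of x y] 2 by (simp add: algebra_simps)
        ultimately show ?thesis using 2 by (simp only: norm_minus_cancel) simp
      next
        case 3
        have "integral {-x..-y} (\<lambda>t. g (- t)) = integral {y..x} g"
          using Henstock_Kurzweil_Integration.integral_reflect_real[of x y g] by simp
        then have "norm (integral {y..x} g - (x - y) *\<^sub>R g x) \<le> e * (x - y)"
          using d2(2)[of "x - y"] y 3 by (intro scale) auto
        moreover have "?F y - ?F x - (y - x) *\<^sub>R - g x = integral {y..x} g - (x - y) *\<^sub>R g x"
          using set_integral_tail_diff[OF g, of y x] 3 by (simp add: algebra_simps)
        ultimately show ?thesis using 3 by simp
      qed
    qed
  qed
  have "negligible (uminus ` N2)"
    using N2(1) by (intro negligible_differentiable_image_negligible) (auto intro!: derivative_intros)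
  then have "N1 \<union> uminus ` N2 \<in> null_sets lebesgue"
    using N1(1) by (simp add: negligible_iff_null_sets[symmetric] negligible_Un)
  then show ?thesis
    by (rule AE_I') (use der in auto)
qed

text \<open>Truncate |g| at a height n for which the excess \<open>?m n\<close> has integral below
  e/2. The truncated part contributes at most n times the total length of the intervals, which
  suggests e / (2 (n + 1)) as modulus; n + 1 also covers n = 0.\<close>

lemma locally_abs_cont_tail_integral:
  fixes g :: "real \<Rightarrow> complex"
  assumes g: "integrable lborel g"
  shows "locally_abs_cont (\<lambda>x. LINT t:{x..}|lborel. g t)"
  unfolding locally_abs_cont_def abs_cont_on_interval_def
proof (intro allI impI)
  let ?F = "\<lambda>x. LINT t:{x..}|lborel. g t"
  fix a b e :: real assume e: "e > 0"
  let ?m = "\<lambda>n t. norm (g t) - min (norm (g t)) (real n)"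
  have gm[measurable]: "g \<in> borel_measurable borel" using g by auto
  have "(\<lambda>n. LINT t|lborel. ?m n t) \<longlonglongrightarrow> (LINT t::real|lborel. 0)"
  proof (rule integral_dominated_convergence[where w="\<lambda>t. norm (g t)"])
    show "integrable lborel (\<lambda>t. norm (g t))" using g by simp
    show "AE t in lborel. (\<lambda>n. ?m n t) \<longlonglongrightarrow> 0"
    proof (rule AE_I2)
      fix t
      obtain n0 :: nat where "norm (g t) \<le> real n0" using real_arch_simple by blast
      then have "eventually (\<lambda>n. ?m n t = 0) sequentially"
        by (intro eventually_sequentiallyI[of n0]) (auto simp: min_def)
      then show "(\<lambda>n. ?m n t) \<longlonglongrightarrow> 0" by (rule tendsto_eventually)
    qed
  qed auto
  then have "eventually (\<lambda>n. (LINT t|lborel. ?m n t) < e / 2) sequentially"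
    using order_tendstoD(2)[of _ 0 _ "e/2"] e by simp
  then obtain n where n: "(LINT t|lborel. ?m n t) < e / 2"
    by (auto simp: eventually_sequentially)
  have mint: "integrable lborel (?m n)"
    by (rule Bochner_Integration.integrable_bound[of _ "\<lambda>t. norm (g t)"]) (use g in auto)
  show "\<exists>d>0. \<forall>(k::nat) u v. (\<forall>i<k. a \<le> u i \<and> u i \<le> v i \<and> v i \<le> b) \<and>
        disjoint_family_on (\<lambda>i. {u i<..<v i}) {..<k} \<and> (\<Sum>i<k. v i - u i) < d
        \<longrightarrow> (\<Sum>i<k. norm (?F (v i) - ?F (u i))) < e"
  proof (intro exI[of _ "e / (2 * (real n + 1))"] conjI allI impI; (elim conjE)?)
    show "e / (2 * (real n + 1)) > 0" using e by simp
    fix k :: nat and u v :: "nat \<Rightarrow> real"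
    assume uv: "\<forall>i<k. a \<le> u i \<and> u i \<le> v i \<and> v i \<le> b"
      and disj: "disjoint_family_on (\<lambda>i. {u i<..<v i}) {..<k}"
      and sm: "(\<Sum>i<k. v i - u i) < e / (2 * (real n + 1))"
    have 1: "norm (?F (v i) - ?F (u i)) \<le> (LINT t|lborel. indicator {u i<..<v i} t * ?m n t) + real n * (v i - u i)"
      if i: "i < k" for i
    proof -
      have le: "u i \<le> v i" using uv i by auto
      have si: "set_integrable lborel {u i<..<v i} g"
        using g by (auto simp: set_integrable_def intro: integrable_mult_indicator)
      have "?F (u i) - ?F (v i) = integral {u i<..<v i} g"
        using set_integral_tail_diff[OF g le] by (simp add: integral_open_interval_real)
      also have "\<dots> = (LINT t:{u i<..<v i}|lborel. g t)"
        using set_borel_integral_eq_integral(2)[OF si] by simp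
      finally have "norm (?F (v i) - ?F (u i)) = norm (LINT t:{u i<..<v i}|lborel. g t)"
        by (metis norm_minus_commute)
      also have "\<dots> \<le> (LINT t|lborel. norm (indicator {u i<..<v i} t *\<^sub>R g t))"
        unfolding set_lebesgue_integral_def by (rule integral_norm_bound)
      also have "\<dots> \<le> (LINT t|lborel. indicator {u i<..<v i} t * ?m n t + real n * indicator {u i<..<v i} t)"
      proof (rule integral_mono)
        show "integrable lborel (\<lambda>t. norm (indicator {u i<..<v i} t *\<^sub>R g t))"
          using integrable_norm[OF si[unfolded set_integrable_def]] .
        show "integrable lborel (\<lambda>t. indicator {u i<..<v i} t * ?m n t + real n * indicator {u i<..<v i} t)"
          using integrable_mult_indicator[OF _ mint, of "{u i<..<v i}"] le by (auto simp: emeasure_lborel_Ioo)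
      qed (auto simp: indicator_def min_def)
      also have "\<dots> = (LINT t|lborel. indicator {u i<..<v i} t * ?m n t) + real n * (v i - u i)"
        using integrable_mult_indicator[OF _ mint, of "{u i<..<v i}"] le
        by (subst Bochner_Integration.integral_add) (auto simp: emeasure_lborel_Ioo)
      finally show ?thesis .
    qed
    have le: "(\<Sum>i<k. norm (?F (v i) - ?F (u i))) \<le> (\<Sum>i<k. (LINT t|lborel. indicator {u i<..<v i} t * ?m n t)) + real n * (\<Sum>i<k. v i - u i)"
      unfolding sum_distrib_left sum.distrib[symmetric] by (rule sum_mono) (use 1 in auto)
    have "(\<Sum>i<k. (LINT t|lborel. indicator {u i<..<v i} t * ?m n t)) = (LINT t|lborel. (\<Sum>i<k. indicator {u i<..<v i} t * ?m n t))"
      using integrable_mult_indicator[OF _ mint] by (subst Bochner_Integration.integral_sum) auto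
    also have "\<dots> \<le> (LINT t|lborel. ?m n t)"
    proof (rule integral_mono)
      show "integrable lborel (\<lambda>t. \<Sum>i<k. indicator {u i<..<v i} t * ?m n t)"
        using integrable_mult_indicator[OF _ mint] by (intro Bochner_Integration.integrable_sum) auto
      fix t
      \<comment> \<open>By disjointness a point lies in at most one of the intervals, so the
        excesses over all intervals together stay below the single integral of
        \<open>?m n\<close>.\<close>
      have "(\<Sum>i<k. indicator {u i<..<v i} t) \<le> (1::real)"
      proof (cases "\<exists>j<k. t \<in> {u j<..<v j}")
        case True
        then obtain j where j: "j < k" "t \<in> {u j<..<v j}" by auto
        have "t \<notin> {u i<..<v i}" if "i < k" "i \<noteq> j" for i
          using disj j that unfolding disjoint_family_on_def by blast
        then have "(\<Sum>i<k. indicator {u i<..<v i} t) = (\<Sum>i<k. if i = j then 1 else (0::real))"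
          using j by (intro sum.cong) (auto simp: indicator_def)
        then show ?thesis using j by simp
      next
        case False
        then have "(\<Sum>i<k. indicator {u i<..<v i} t) = (\<Sum>i<k. (0::real))"
          by (intro sum.cong) (auto simp: indicator_def)
        then show ?thesis by simp
      qed
      moreover have "?m n t \<ge> 0" by simp
      ultimately show "(\<Sum>i<k. indicator {u i<..<v i} t * ?m n t) \<le> ?m n t"
        unfolding sum_distrib_right[symmetric] by (intro mult_left_le_one_le sum_nonneg) auto
    qed (rule mint)
    also have "\<dots> < e / 2" by (rule n)
    finally have 2: "(\<Sum>i<k. (LINT t|lborel. indicator {u i<..<v i} t * ?m n t)) < e / 2" .
    have "real n * (\<Sum>i<k. v i - u i) \<le> (real n + 1) * (e / (2 * (real n + 1)))"
      using sm uv by (intro mult_mono) (auto intro!: sum_nonneg)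
    also have "\<dots> = e / 2" by (simp add: field_simps)
    finally show "(\<Sum>i<k. norm (?F (v i) - ?F (u i))) < e" using le 2 by linarith
  qed
qed

lemma locally_abs_cont_add:
  assumes f: "locally_abs_cont f" and g: "locally_abs_cont g"
  shows "locally_abs_cont (\<lambda>x. f x + g x)"
  unfolding locally_abs_cont_def abs_cont_on_interval_def
proof (intro allI impI)
  fix a b e :: real assume e: "e > 0"
  from e have "e / 2 > 0" by simp
  then obtain d1 where d1: "d1 > 0" "\<forall>(n::nat) u v. (\<forall>i<n. a \<le> u i \<and> u i \<le> v i \<and> v i \<le> b) \<and>
        disjoint_family_on (\<lambda>i. {u i<..<v i}) {..<n} \<and> (\<Sum>i<n. v i - u i) < d1
        \<longrightarrow> (\<Sum>i<n. norm (f (v i) - f (u i))) < e / 2"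
    using f[unfolded locally_abs_cont_def abs_cont_on_interval_def, THEN spec, THEN spec, THEN spec, THEN mp, of "e / 2" a b] by blast
  from e have "e / 2 > 0" by simp
  then obtain d2 where d2: "d2 > 0" "\<forall>(n::nat) u v. (\<forall>i<n. a \<le> u i \<and> u i \<le> v i \<and> v i \<le> b) \<and>
        disjoint_family_on (\<lambda>i. {u i<..<v i}) {..<n} \<and> (\<Sum>i<n. v i - u i) < d2
        \<longrightarrow> (\<Sum>i<n. norm (g (v i) - g (u i))) < e / 2"
    using g[unfolded locally_abs_cont_def abs_cont_on_interval_def, THEN spec, THEN spec, THEN spec, THEN mp, of "e / 2" a b] by blast
  show "\<exists>d>0. \<forall>(n::nat) u v. (\<forall>i<n. a \<le> u i \<and> u i \<le> v i \<and> v i \<le> b) \<and>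
        disjoint_family_on (\<lambda>i. {u i<..<v i}) {..<n} \<and> (\<Sum>i<n. v i - u i) < d
        \<longrightarrow> (\<Sum>i<n. norm (f (v i) + g (v i) - (f (u i) + g (u i)))) < e"
  proof (intro exI[of _ "min d1 d2"] conjI allI impI; (elim conjE)?)
    fix n :: nat and u v
    assume *: "\<forall>i<n. a \<le> u i \<and> u i \<le> v i \<and> v i \<le> b"
       "disjoint_family_on (\<lambda>i. {u i<..<v i}) {..<n}" "(\<Sum>i<n. v i - u i) < min d1 d2"
    have "(\<Sum>i<n. norm (f (v i) + g (v i) - (f (u i) + g (u i))))
        \<le> (\<Sum>i<n. norm (f (v i) - f (u i)) + norm (g (v i) - g (u i)))"
      by (intro sum_mono) (simp add: add_diff_add norm_triangle_ineq)
    also have "\<dots> < e"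
      using d1(2)[THEN spec, THEN spec, THEN spec, THEN mp, of n u v]
        d2(2)[THEN spec, THEN spec, THEN spec, THEN mp, of n u v] * by (simp add: sum.distrib)
    finally show "(\<Sum>i<n. norm (f (v i) + g (v i) - (f (u i) + g (u i)))) < e" .
  qed (use d1 d2 in auto)
qed

lemma locally_abs_cont_C1:
  assumes der: "\<And>x. (f has_vector_derivative f' x) (at x)" and cont: "continuous_on UNIV f'"
  shows "locally_abs_cont f"
  unfolding locally_abs_cont_def abs_cont_on_interval_def
proof (intro allI impI)
  fix a b e :: real assume e: "e > 0"
  have "bounded (f' ` {a..b})"
    by (intro compact_imp_bounded compact_continuous_image continuous_on_subset[OF cont]) auto
  then obtain B where B: "B > 0" "\<And>x. a \<le> x \<Longrightarrow> x \<le> b \<Longrightarrow> norm (f' x) \<le> B"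
    by (auto simp: bounded_pos)
  have lip: "norm (f y - f x) \<le> B * (y - x)" if "a \<le> x" "x \<le> y" "y \<le> b" for x y
  proof -
    have "norm (f y - f x) \<le> B * norm (y - x)"
      by (rule differentiable_bound[of "{x..y}" f "\<lambda>x h. h *\<^sub>R f' x"])
        (use that in \<open>auto intro: has_vector_derivative_at_within[OF der, unfolded has_vector_derivative_def]
          intro!: onorm_bound mult_left_mono B simp: mult.commute[of B] less_imp_le[OF B(1)]\<close>)
    then show ?thesis using that by simp
  qed
  show "\<exists>d>0. \<forall>(n::nat) u v. (\<forall>i<n. a \<le> u i \<and> u i \<le> v i \<and> v i \<le> b) \<and>
        disjoint_family_on (\<lambda>i. {u i<..<v i}) {..<n} \<and> (\<Sum>i<n. v i - u i) < d
        \<longrightarrow> (\<Sum>i<n. norm (f (v i) - f (u i))) < e"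
  proof (intro exI[of _ "e / B"] conjI allI impI; (elim conjE)?)
    fix n :: nat and u v
    assume *: "\<forall>i<n. a \<le> u i \<and> u i \<le> v i \<and> v i \<le> b" "(\<Sum>i<n. v i - u i) < e / B"
    have "(\<Sum>i<n. norm (f (v i) - f (u i))) \<le> (\<Sum>i<n. B * (v i - u i))"
      by (intro sum_mono lip) (use * in auto)
    also have "\<dots> = B * (\<Sum>i<n. v i - u i)" by (simp add: sum_distrib_left)
    also have "\<dots> < B * (e / B)" using * B by (intro mult_strict_left_mono) auto
    finally show "(\<Sum>i<n. norm (f (v i) - f (u i))) < e" using B by simp
  qed (use e B in auto)
qed

section \<open>Parameter integrals\<close>

text \<open>As a limit of difference quotients, differentiability can be tested along sequences,
  which is the form that dominated convergence delivers.\<close>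

lemma has_vector_derivative_iff_quotient:
  fixes F :: "real \<Rightarrow> 'a::real_normed_vector"
  shows "(F has_vector_derivative D) (at x) \<longleftrightarrow> ((\<lambda>y. (F y - F x) /\<^sub>R (y - x)) \<longlongrightarrow> D) (at x)"
proof -
  have eq: "norm (F y - F x - (y - x) *\<^sub>R D) / norm (y - x) = norm ((F y - F x) /\<^sub>R (y - x) - D)" if "y \<noteq> x" for y
  proof -
    have "(F y - F x) /\<^sub>R (y - x) - D = (F y - F x - (y - x) *\<^sub>R D) /\<^sub>R (y - x)"
      using that by (simp add: scaleR_diff_right)
    then show ?thesis by (simp add: divide_inverse mult.commute)
  qed
  have "(F has_vector_derivative D) (at x) \<longleftrightarrow>
      ((\<lambda>y. norm (F y - F x - (y - x) *\<^sub>R D) / norm (y - x)) \<longlongrightarrow> 0) (at x)"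
    by (simp add: has_vector_derivative_def has_derivative_iff_norm bounded_linear_scaleR_left)
  also have "\<dots> \<longleftrightarrow> ((\<lambda>y. norm ((F y - F x) /\<^sub>R (y - x) - D)) \<longlongrightarrow> 0) (at x)"
    by (intro Lim_cong_within refl eq)
  finally show ?thesis by (simp add: tendsto_norm_zero_iff LIM_zero_iff)
qed

text \<open>Since \<open>\<phi> 0 = 0\<close>, the kernel cut off to \<open>z \<le> 0\<close> is \<open>\<phi> (min z 0)\<close>, which is still locally Lipschitz;
  hence dominated convergence yields a derivative everywhere although \<open>g\<close> is only measurable.\<close>

lemma tail_convolution_has_vector_derivative:
  fixes \<phi> \<phi>' g :: "real \<Rightarrow> complex"
  assumes der: "\<And>z. (\<phi> has_vector_derivative \<phi>' z) (at z)" and "\<phi> 0 = 0"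
    and [measurable]: "\<phi>' \<in> borel_measurable borel"
    and bound0: "\<And>z. norm (\<phi> z) \<le> C * exp (d * \<bar>z\<bar>)"
    and bound: "\<And>z. norm (\<phi>' z) \<le> C * exp (d * \<bar>z\<bar>)" and "d \<ge> 0"
    and g: "integrable lborel (\<lambda>t. norm (g t) * exp (d * \<bar>t\<bar>))" and [measurable]: "g \<in> borel_measurable borel"
  shows "((\<lambda>x. LINT t:{x..}|lborel. \<phi> (x - t) * g t) has_vector_derivative
           (LINT t:{x..}|lborel. \<phi>' (x - t) * g t)) (at x)"
unfolding has_vector_derivative_iff_quotient tendsto_at_iff_sequentially o_def
proof (intro allI impI)
  have C: "C \<ge> 0" using bound[of 0] norm_ge_zero[of "\<phi>' 0"] by (simp del: norm_ge_zero)
  have [measurable]: "\<phi> \<in> borel_measurable borel"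
    by (intro borel_measurable_continuous_onI continuous_at_imp_continuous_on ballI has_vector_derivative_continuous[OF der])
  have lip: "norm (\<phi> z - \<phi> w) \<le> C * exp (d * m) * \<bar>z - w\<bar>" if "\<bar>z\<bar> \<le> m" "\<bar>w\<bar> \<le> m" for z w m
  proof -
    have b: "norm (\<phi>' z) \<le> C * exp (d * m)" if "\<bar>z\<bar> \<le> m" for z
      using that \<open>d \<ge> 0\<close> C by (intro order_trans[OF bound] mult_left_mono) (auto intro!: mult_left_mono)
    have "norm (\<phi> z - \<phi> w) \<le> C * exp (d * m) * norm (z - w)"
    proof (rule differentiable_bound[of "{-m..m}" \<phi> "\<lambda>x h. h *\<^sub>R \<phi>' x"])
      show "(\<phi> has_derivative (\<lambda>h. h *\<^sub>R \<phi>' x)) (at x within {-m..m})" for x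
        using has_vector_derivative_at_within[OF der] unfolding has_vector_derivative_def .
      show "onorm (\<lambda>h. h *\<^sub>R \<phi>' x) \<le> C * exp (d * m)" if "x \<in> {-m..m}" for x
      proof (rule onorm_bound)
        show "norm (h *\<^sub>R \<phi>' x) \<le> C * exp (d * m) * norm h" for h
          using mult_left_mono[OF b[of x], of "\<bar>h\<bar>"] that by (auto simp: mult.commute)
      qed (use C in simp)
    qed (use that in auto)
    then show ?thesis by simp
  qed
  let ?\<Phi> = "\<lambda>z. \<phi> (min z 0)"
  have tail: "(LINT t:{y..}|lborel. \<phi> (y - t) * g t) = (LINT t|lborel. ?\<Phi> (y - t) * g t)" for y
    unfolding set_lebesgue_integral_def
    using \<open>\<phi> 0 = 0\<close> by (intro Bochner_Integration.integral_cong) (auto simp: indicator_def min_def)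
  \<comment> \<open>Both arguments stay within |x| + r + |t|, where the Lipschitz constant of
    \<open>\<phi>\<close> is known, and cutting off by \<open>min\<close> does not increase
    distances. The exponential then splits into a constant and the weight under which
    \<open>g\<close> is integrable.\<close>
  have dom: "norm ((?\<Phi> (y - t) - ?\<Phi> (x - t)) * g t) \<le> \<bar>y - x\<bar> * (C * exp (d * (\<bar>x\<bar> + r)) * (norm (g t) * exp (d * \<bar>t\<bar>)))"
    if "\<bar>y - x\<bar> \<le> r" for y t r
  proof -
    have "norm (?\<Phi> (y - t) - ?\<Phi> (x - t)) \<le> C * exp (d * (\<bar>x\<bar> + r + \<bar>t\<bar>)) * \<bar>min (y - t) 0 - min (x - t) 0\<bar>"
      by (rule lip) (use that in auto)
    also have "\<dots> \<le> C * exp (d * (\<bar>x\<bar> + r + \<bar>t\<bar>)) * \<bar>y - x\<bar>"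
      using C by (intro mult_left_mono) auto
    finally have "norm ((?\<Phi> (y - t) - ?\<Phi> (x - t)) * g t) \<le> C * exp (d * (\<bar>x\<bar> + r + \<bar>t\<bar>)) * \<bar>y - x\<bar> * norm (g t)"
      unfolding norm_mult by (rule mult_right_mono) simp
    then show ?thesis by (simp add: algebra_simps exp_add)
  qed
  have int0: "integrable lborel (\<lambda>t. ?\<Phi> (y - t) * g t)" for y
  proof (rule Bochner_Integration.integrable_bound)
    show "integrable lborel (\<lambda>t. C * exp (d * \<bar>y\<bar>) * (norm (g t) * exp (d * \<bar>t\<bar>)))" using g by simp
    have "norm (?\<Phi> (y - t)) \<le> C * exp (d * (\<bar>y\<bar> + \<bar>t\<bar>))" for t
    proof -
      have "d * \<bar>min (y - t) 0\<bar> \<le> d * (\<bar>y\<bar> + \<bar>t\<bar>)" by (rule mult_left_mono[OF _ \<open>d \<ge> 0\<close>]) auto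
      then show ?thesis using C by (intro order_trans[OF bound0] mult_left_mono) auto
    qed
    then have "norm (?\<Phi> (y - t)) * norm (g t) \<le> C * exp (d * (\<bar>y\<bar> + \<bar>t\<bar>)) * norm (g t)" for t
      by (rule mult_right_mono) simp
    then show "AE t in lborel. norm (?\<Phi> (y - t) * g t) \<le> norm (C * exp (d * \<bar>y\<bar>) * (norm (g t) * exp (d * \<bar>t\<bar>)))"
      using C by (intro AE_I2) (simp add: norm_mult distrib_left exp_add mult_ac)
  qed measurable
  fix Y :: "nat \<Rightarrow> real" assume "\<forall>n. Y n \<in> UNIV - {x}" and "Y \<longlonglongrightarrow> x"
  then have Y: "\<And>n. Y n \<noteq> x" "Y \<longlonglongrightarrow> x" by auto
  show "(\<lambda>n. ((LINT t:{Y n..}|lborel. \<phi> (Y n - t) * g t) - (LINT t:{x..}|lborel. \<phi> (x - t) * g t)) /\<^sub>R (Y n - x))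
     \<longlonglongrightarrow> (LINT t:{x..}|lborel. \<phi>' (x - t) * g t)"
    unfolding tail
  proof -
    obtain r where r: "\<bar>Y n - x\<bar> \<le> r" for n
      using Y(2) by (metis convergentI convergent_imp_Bseq BseqD LIM_zero_iff Bseq_def real_norm_def)
    let ?w = "\<lambda>t. C * exp (d * (\<bar>x\<bar> + r)) * (norm (g t) * exp (d * \<bar>t\<bar>))"
    let ?s = "\<lambda>n t. ((?\<Phi> (Y n - t) - ?\<Phi> (x - t)) * g t) /\<^sub>R (Y n - x)"
    have "(\<lambda>n. LINT t|lborel. ?s n t) \<longlonglongrightarrow> (LINT t|lborel. indicator {x..} t *\<^sub>R (\<phi>' (x - t) * g t))"
    proof (rule integral_dominated_convergence[where w="?w"])
      show "integrable lborel ?w" using g by simp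
      show "AE t in lborel. norm (?s n t) \<le> ?w t" for n
      proof (rule AE_I2)
        fix t
        have "norm (?s n t) = norm ((?\<Phi> (Y n - t) - ?\<Phi> (x - t)) * g t) / \<bar>Y n - x\<bar>"
          by (simp only: norm_scaleR abs_inverse divide_inverse mult.commute)
        also have "\<dots> \<le> ?w t"
          using dom[OF r, of n t] Y(1)[of n] by (subst pos_divide_le_eq) (simp_all only: mult.commute zero_less_abs_iff right_minus_eq not_False_eq_True)
        finally show "norm (?s n t) \<le> ?w t" .
      qed
      \<comment> \<open>At t = x the cut-off function may have a corner, with different one-sided
        derivatives; this single point is a null set.\<close>
      have "AE t in lborel. t \<noteq> x" by (rule AE_lborel_singleton)
      then show "AE t in lborel. (\<lambda>n. ?s n t) \<longlonglongrightarrow> indicator {x..} t *\<^sub>R (\<phi>' (x - t) * g t)"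
      proof eventually_elim
        case (elim t)
        show ?case
        proof (cases "t < x")
          case True
          then have "eventually (\<lambda>n. Y n > t) sequentially" using order_tendstoD(1)[OF Y(2)] by blast
          then have "eventually (\<lambda>n. ?s n t = 0) sequentially"
            by eventually_elim (use True in \<open>auto simp: min_def\<close>)
          then show ?thesis using True by (simp add: tendsto_eventually)
        next
          case False
          then have "t > x" using elim by simp
          then have ev: "eventually (\<lambda>n. Y n < t) sequentially" using order_tendstoD(2)[OF Y(2)] by blast
          have "((\<lambda>y. (\<phi> y - \<phi> (x - t)) /\<^sub>R (y - (x - t))) \<longlongrightarrow> \<phi>' (x - t)) (at (x - t))"
            using der[of "x - t"] by (simp add: has_vector_derivative_iff_quotient)
          moreover have "(\<lambda>n. Y n - t) \<longlonglongrightarrow> x - t" by (intro tendsto_intros Y(2))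
          ultimately have "(\<lambda>n. (\<phi> (Y n - t) - \<phi> (x - t)) /\<^sub>R (Y n - t - (x - t))) \<longlonglongrightarrow> \<phi>' (x - t)"
            using Y(1) unfolding tendsto_at_iff_sequentially o_def by (auto dest!: spec[of _ "\<lambda>n. Y n - t"])
          then have "(\<lambda>n. (\<phi> (Y n - t) - \<phi> (x - t)) /\<^sub>R (Y n - x) * g t) \<longlonglongrightarrow> \<phi>' (x - t) * g t"
            by (intro tendsto_mult_right) simp
          moreover have "eventually (\<lambda>n. (\<phi> (Y n - t) - \<phi> (x - t)) /\<^sub>R (Y n - x) * g t = ?s n t) sequentially"
            using ev by eventually_elim (use \<open>t > x\<close> in \<open>auto simp: min_def\<close>)
          ultimately show ?thesis using \<open>t > x\<close> by (auto intro: Lim_transform_eventually)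
        qed
      qed
    qed measurable
    moreover have "(LINT t|lborel. ?s n t) = ((LINT t|lborel. ?\<Phi> (Y n - t) * g t) - (LINT t|lborel. ?\<Phi> (x - t) * g t)) /\<^sub>R (Y n - x)" for n
      by (simp add: left_diff_distrib Bochner_Integration.integral_diff[OF int0 int0] integral_scaleR_right)
    ultimately show "(\<lambda>n. ((LINT t|lborel. ?\<Phi> (Y n - t) * g t) - (LINT t|lborel. ?\<Phi> (x - t) * g t)) /\<^sub>R (Y n - x))
      \<longlonglongrightarrow> (LINT t:{x..}|lborel. \<phi>' (x - t) * g t)"
      unfolding set_lebesgue_integral_def by (simp only:)
  qed
qed

text \<open>Cauchy's inequality turns the majorant \<open>h\<close> of the functions into the
  majorant \<open>h t / r\<close> of their derivatives in \<open>l\<close>, hence of the difference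
  quotients, and dominated convergence applies.\<close>

lemma holomorphic_on_integral:
  fixes f :: "complex \<Rightarrow> 'a \<Rightarrow> complex"
  assumes "open S" and hol: "\<And>t. (\<lambda>l. f l t) holomorphic_on S"
    and meas: "\<And>l. l \<in> S \<Longrightarrow> f l \<in> borel_measurable M"
    and bound: "\<And>l t. l \<in> S \<Longrightarrow> norm (f l t) \<le> h t" and h: "integrable M h"
  shows "(\<lambda>l. LINT t|M. f l t) holomorphic_on S"
  unfolding holomorphic_on_open[OF \<open>open S\<close>]
proof
  fix l0 assume "l0 \<in> S"
  then obtain R where R: "R > 0" "cball l0 R \<subseteq> S" using \<open>open S\<close> open_contains_cball by blast
  \<comment> \<open>With half the radius, the closed disc of radius r about any point of
    \<open>ball l0 r\<close> still lies in \<open>cball l0 R\<close>, so Cauchy's inequality is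
    available at every such point.\<close>
  define r where "r = R / 2"
  have r: "r > 0" "r + r = R" using R by (auto simp: r_def)
  define f' where "f' = (\<lambda>t. deriv (\<lambda>l. f l t) l0)"
  have dq: "norm ((f l t - f l0 t) / (l - l0)) \<le> h t / r" if l: "l \<in> ball l0 r" "l \<noteq> l0" for l t
  proof -
    have "norm (f l t - f l0 t) \<le> h t / r * norm (l - l0)"
    proof (rule field_differentiable_bound[of "ball l0 r" "\<lambda>l. f l t" "deriv (\<lambda>l. f l t)"])
      fix z assume z: "z \<in> ball l0 r"
      have sub: "cball z r \<subseteq> S"
      proof (rule order_trans[OF _ R(2)], rule subsetI)
        fix w assume "w \<in> cball z r"
        then show "w \<in> cball l0 R" using z r dist_triangle[of l0 w z] by auto
      qed
      have "z \<in> S" using sub r by auto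
      show "((\<lambda>l. f l t) has_field_derivative deriv (\<lambda>l. f l t) z) (at z within ball l0 r)"
        using holomorphic_derivI[OF hol \<open>open S\<close> \<open>z \<in> S\<close>] by (rule has_field_derivative_at_within)
      have "norm ((deriv ^^ 1) (\<lambda>l. f l t) z) \<le> fact 1 * h t / r ^ 1"
      proof (rule Cauchy_inequality)
        show "(\<lambda>l. f l t) holomorphic_on ball z r"
          using hol sub by (meson ball_subset_cball holomorphic_on_subset subset_trans)
        show "continuous_on (cball z r) (\<lambda>l. f l t)"
          using hol sub by (meson holomorphic_on_imp_continuous_on holomorphic_on_subset)
        show "norm (f w t) \<le> h t" if "norm (z - w) = r" for w
          using that sub by (intro bound) (auto simp: dist_norm)
      qed (use r in simp)
      then show "norm (deriv (\<lambda>l. f l t) z) \<le> h t / r" by simp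
    qed (use l r in auto)
    then show ?thesis using l by (simp add: norm_divide divide_le_eq)
  qed
  have der: "((\<lambda>l. f l t) has_field_derivative f' t) (at l0)" for t
    unfolding f'_def by (rule holomorphic_derivI[OF hol \<open>open S\<close> \<open>l0 \<in> S\<close>])
  have lim: "(\<lambda>n. (LINT t|M. (f (Y n) t - f l0 t) / (Y n - l0))) \<longlonglongrightarrow> (LINT t|M. f' t)"
    if Y: "\<And>n. Y n \<in> ball l0 r - {l0}" "Y \<longlonglongrightarrow> l0" for Y
  proof (rule integral_dominated_convergence[where w="\<lambda>t. h t / r"])
    have inS: "Y n \<in> S" for n using Y(1)[of n] R r by auto
    show m: "(\<lambda>t. (f (Y n) t - f l0 t) / (Y n - l0)) \<in> borel_measurable M" for n
      using meas[OF inS[of n]] meas[OF \<open>l0 \<in> S\<close>] by measurable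
    have c: "(\<lambda>n. (f (Y n) t - f l0 t) / (Y n - l0)) \<longlonglongrightarrow> f' t" for t
      using der[of t] Y unfolding has_field_derivative_iff tendsto_at_iff_sequentially o_def
      by (auto dest!: spec[of _ Y])
    show "AE t in M. (\<lambda>n. (f (Y n) t - f l0 t) / (Y n - l0)) \<longlonglongrightarrow> f' t" using c by simp
    show "f' \<in> borel_measurable M" by (rule borel_measurable_LIMSEQ_metric[OF m c])
    show "AE t in M. norm ((f (Y n) t - f l0 t) / (Y n - l0)) \<le> h t / r" for n
      using Y(1)[of n] by (intro AE_I2 dq) auto
  qed (use h in simp)
  have int: "integrable M (f l)" if "l \<in> S" for l
    
  proof (rule Bochner_Integration.integrable_bound[OF h meas[OF that]], rule AE_I2)
    fix t show "norm (f l t) \<le> norm (h t)" using bound[OF that, of t] by simp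
  qed
  have "((\<lambda>l. ((LINT t|M. f l t) - (LINT t|M. f l0 t)) / (l - l0)) \<longlongrightarrow> (LINT t|M. f' t)) (at l0 within ball l0 r)"
    unfolding tendsto_at_iff_sequentially o_def
  proof (intro allI impI)
    fix Y assume Y: "\<forall>n. Y n \<in> ball l0 r - {l0}" "Y \<longlonglongrightarrow> l0"
    have "Y n \<in> S" for n using Y(1)[rule_format, of n] R r by auto
    then have "(LINT t|M. (f (Y n) t - f l0 t) / (Y n - l0)) = ((LINT t|M. f (Y n) t) - (LINT t|M. f l0 t)) / (Y n - l0)" for n
      using int[of "Y n"] int[OF \<open>l0 \<in> S\<close>] by simp
    then show "(\<lambda>n. ((LINT t|M. f (Y n) t) - (LINT t|M. f l0 t)) / (Y n - l0)) \<longlonglongrightarrow> (LINT t|M. f' t)"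
      using lim[of Y] Y by auto
  qed
  then have "((\<lambda>l. LINT t|M. f l t) has_field_derivative (LINT t|M. f' t)) (at l0 within ball l0 r)"
    unfolding has_field_derivative_iff .
  then show "\<exists>f''. ((\<lambda>l. LINT t|M. f l t) has_field_derivative f'') (at l0)"
    using at_within_open[of l0 "ball l0 r"] r by auto
qed

text \<open>The weight \<open>exp (k * Q)\<close> replaces the factorials of the usual Volterra estimate: the bound is
  additive over adjacent intervals and immediate where \<open>Q\<close> varies by less than \<open>ln 2 / k\<close>.\<close>

lemma integral_mult_exp_primitive_le:
  fixes p :: "real \<Rightarrow> real"
  assumes p: "integrable lborel p" and p0: "\<And>t. p t \<ge> 0" and "k > 0" "x \<le> t"
  defines "Q \<equiv> \<lambda>t. LINT s:{..t}|lborel. p s"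
  shows "set_integrable lborel {x..t} (\<lambda>s. p s * exp (k * Q s))"
    and "k * (LINT s:{x..t}|lborel. p s * exp (k * Q s)) \<le> 2 * (exp (k * Q t) - exp (k * Q x))"
proof -
  have [measurable]: "p \<in> borel_measurable borel" using p by auto
  have si: "set_integrable lborel A p" if "A \<in> sets borel" for A
    unfolding set_integrable_def by (rule integrable_mult_indicator[OF _ p]) (use that in simp)
  have io: "p integrable_on {a..b}" for a b by (intro set_borel_integral_eq_integral(1) si) simp
  have Qd: "Q b - Q a = integral {a..b} p" if "a \<le> b" for a b
  proof -
    have "integral ({..a} \<union> {a..b}) p = integral {..a} p + integral {a..b} p"
    proof (rule Henstock_Kurzweil_Integration.integral_Un)
      have "{..a} \<inter> {a..b} = {a}" using that by auto
      then show "negligible ({..a} \<inter> {a..b})" by simp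
    qed (use si[THEN set_borel_integral_eq_integral(1)] in auto)
    moreover have "{..a} \<union> {a..b} = {..b}" using that by auto
    ultimately show ?thesis unfolding Q_def
      using si[THEN set_borel_integral_eq_integral(2)] by simp
  qed
  have Qmono: "Q a \<le> Q b" if "a \<le> b" for a b
    using Qd[OF that] Henstock_Kurzweil_Integration.integral_nonneg[OF io, of a b] p0 by simp
  have Qc: "isCont Q y" for y
  proof -
    have "continuous_on {y - 1..y + 1} (\<lambda>z. Q (y - 1) + integral {y - 1..z} p)"
      by (intro continuous_intros indefinite_integral_continuous_1 io)
    then have "continuous_on {y - 1..y + 1} Q"
    proof (rule continuous_on_eq)
      fix z assume "z \<in> {y - 1..y + 1}"
      then show "Q (y - 1) + integral {y - 1..z} p = Q z" using Qd[of "y - 1" z] by simp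
    qed
    then have "continuous_on {y - 1<..<y + 1} Q" by (rule continuous_on_subset) auto
    then show ?thesis by (simp add: continuous_on_eq_continuous_at)
  qed
  have Qm[measurable]: "Q \<in> borel_measurable borel"
    by (intro borel_measurable_continuous_onI) (simp add: Qc continuous_at_imp_continuous_on)
  let ?w = "\<lambda>s. p s * exp (k * Q s)"
  have sw: "set_integrable lborel {a..b} ?w" for a b
    unfolding set_integrable_def
  proof (rule Bochner_Integration.integrable_bound[where f="\<lambda>s. exp (k * Q b) * p s"])
    show "AE s in lborel. norm (indicator {a..b} s *\<^sub>R ?w s) \<le> norm (exp (k * Q b) * p s)"
      using p0 Qmono \<open>k > 0\<close> by (intro AE_I2) (auto simp: indicator_def mult.commute intro!: mult_left_mono)
  qed (use p in auto)
  then show "set_integrable lborel {x..t} ?w" .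
  have wo: "?w integrable_on {a..b}" for a b by (rule set_borel_integral_eq_integral(1)[OF sw])
  \<comment> \<open>The chain rule would give the bound without the factor 2, but \<open>Q\<close>
    is in general differentiable only almost everywhere. The factor leaves room for a bisection
    argument that uses only continuity and monotonicity of \<open>Q\<close>.\<close>
  have "k * integral {x..t} ?w \<le> 2 * (exp (k * Q t) - exp (k * Q x))"
    using \<open>x \<le> t\<close>
  proof (induction rule: Bolzano[where P="\<lambda>a b. k * integral {a..b} ?w \<le> 2 * (exp (k * Q b) - exp (k * Q a))"])
    case (trans a b c)
    then show ?case
    proof -
      have "integral {a..c} ?w = integral {a..b} ?w + integral {b..c} ?w"
        using trans Henstock_Kurzweil_Integration.integral_combine[of a b c ?w, OF _ _ wo] by simp
      then have "k * integral {a..c} ?w = k * integral {a..b} ?w + k * integral {b..c} ?w"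
        by (simp only: distrib_left)
      moreover have "A + B \<le> 2 * (w - u)" if "A \<le> 2 * (v - u)" "B \<le> 2 * (w - v)" for A B u v w :: real
        using that by simp
      ultimately show ?thesis using trans(1,2) by (simp only:)
    qed
  next
    case (local y)
    \<comment> \<open>The values at a and at b each differ from the value at y by less than this
      amount, so k (Q b - Q a) stays below ln 2 and the weight at most doubles on the
      interval.\<close>
    have "ln 2 / (2 * k) > 0" using \<open>k > 0\<close> by simp
    then obtain d where d: "d > 0" "\<And>z. \<bar>z - y\<bar> < d \<Longrightarrow> \<bar>Q z - Q y\<bar> < ln 2 / (2 * k)"
      using Qc[of y] unfolding continuous_at_eps_delta by (metis dist_real_def)
    show ?case
    proof (intro exI[of _ d] conjI allI impI)
      fix a b assume ab: "a \<le> y \<and> y \<le> b \<and> b - a < d"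
      have "Q b - Q a \<le> ln 2 / (2 * k) + ln 2 / (2 * k)"
        using d(2)[of a] d(2)[of b] ab by auto
      also have "\<dots> = ln 2 / k" by (simp add: field_simps)
      finally have "k * (Q b - Q a) \<le> ln 2" using \<open>k > 0\<close> by (simp add: field_simps)
      then have "exp (k * (Q b - Q a)) \<le> exp (ln 2)" by (simp only: exp_le_cancel_iff)
      then have e2: "exp (k * Q b) \<le> 2 * exp (k * Q a)" by (simp add: right_diff_distrib exp_diff field_simps)
      have "integral {a..b} ?w \<le> integral {a..b} (\<lambda>s. p s * exp (k * Q b))"
        using p0 Qmono \<open>k > 0\<close> by (intro integral_le wo integrable_on_mult_left io mult_left_mono) auto
      also have "\<dots> = (Q b - Q a) * exp (k * Q b)" using Qd[of a b] ab by simp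
      finally have "k * integral {a..b} ?w \<le> k * ((Q b - Q a) * exp (k * Q b))" using \<open>k > 0\<close> by simp
      also have "\<dots> \<le> k * (Q b - Q a) * (2 * exp (k * Q a))"
        using mult_left_mono[OF e2, of "k * (Q b - Q a)"] \<open>k > 0\<close> Qmono[of a b] ab by (simp add: mult.assoc)
      also have "\<dots> = 2 * exp (k * Q a) * (k * (Q b - Q a))" by simp
      also have "\<dots> \<le> 2 * exp (k * Q a) * (exp (k * (Q b - Q a)) - 1)"
      proof (rule mult_left_mono)
        show "k * (Q b - Q a) \<le> exp (k * (Q b - Q a)) - 1"
          using exp_ge_add_one_self[of "k * (Q b - Q a)"] by linarith
      qed simp
      also have "\<dots> = 2 * (exp (k * Q b) - exp (k * Q a))"
        by (simp add: right_diff_distrib exp_diff)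
      finally show "k * integral {a..b} ?w \<le> 2 * (exp (k * Q b) - exp (k * Q a))" .
    qed (rule d)
  qed
  then show "k * (LINT s:{x..t}|lborel. ?w s) \<le> 2 * (exp (k * Q t) - exp (k * Q x))"
    using set_borel_integral_eq_integral(2)[OF sw] by simp
qed

section \<open>The kernel\<close>

definition omega :: complex where "omega = (- 1 + \<i> * of_real (sqrt 3)) / 2"

definition omega' :: complex where "omega' = (- 1 - \<i> * of_real (sqrt 3)) / 2"

lemma zeta_simps [simp]:
  "zeta 0 = 1" "zeta (Suc 0) = omega" "zeta 2 = omega'"
  by (auto simp: zeta_def omega_def omega'_def)

lemma zeta_cases: "zeta k = 1 \<or> zeta k = omega \<or> zeta k = omega'"
  unfolding zeta_def omega_def omega'_def by presburger

lemma omega_add: "omega + omega' = - 1"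
  by (simp add: omega_def omega'_def complex_eq_iff)

lemma omega_mult:
  "omega * omega = omega'" "omega * omega' = 1" "omega' * omega = 1" "omega' * omega' = omega"
proof -
  have 3: "complex_of_real (sqrt 3) * of_real (sqrt 3) = 3"
    by (simp only: of_real_mult[symmetric]) simp
  show "omega * omega = omega'" "omega * omega' = 1" "omega' * omega = 1" "omega' * omega' = omega"
    by (simp_all add: omega_def omega'_def algebra_simps 3 add_divide_distrib diff_divide_distrib)
qed

lemma omega_mult_left:
  "omega * (omega * w) = omega' * w" "omega * (omega' * w) = w" "omega' * (omega * w) = w" "omega' * (omega' * w) = omega * w"
  using omega_mult by (simp_all only: mult.assoc[symmetric] mult_1_left)

lemma zeta_cube: "zeta k * (zeta k * zeta k) = 1"
  using zeta_cases[of k] by (auto simp: omega_mult)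

lemma norm_zeta [simp]: "norm (zeta k) = 1"
proof -
  have "norm (zeta k) ^ 3 = 1 ^ 3"
    using arg_cong[OF zeta_cube[of k], of norm] by (simp add: norm_mult power3_eq_cube mult.assoc)
  then show ?thesis by (subst (asm) power_eq_iff_eq_base) auto
qed

lemma norm_omega [simp]: "norm omega = 1" "norm omega' = 1"
  using norm_zeta[of "Suc 0"] norm_zeta[of 2] by simp_all

lemma zeta_nz: "zeta k \<noteq> 0"
  using zeta_cube[of k] by auto

lemma zeta_powi_minus_2: "zeta k powi (- 2) = zeta k"
  using zeta_cube[of k] zeta_nz[of k] by (simp add: power_int_minus power2_eq_square divide_simps mult_ac)

lemma omega_mult_zeta:
  assumes "k \<in> {0..2}"
  shows "omega * zeta k = zeta ((k + 1) mod 3)"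
proof -
  have "k = 0 \<or> k = Suc 0 \<or> k = 2" using assms by auto
  moreover have "zeta (Suc (Suc 0)) = omega'" using zeta_simps(3) by (simp only: numeral_2_eq_2)
  moreover have "Suc 2 mod 3 = 0" by simp
  ultimately show ?thesis by (auto simp: omega_mult)
qed

lemma s2_eq: "s2 w = (exp w + omega * exp (omega * w) + omega' * exp (omega' * w)) / 3"
proof -
  have "{0..2} = {0, Suc 0, 2::nat}" by auto
  then show ?thesis unfolding s2_def zeta_powi_minus_2 by (simp add: add.assoc)
qed

text \<open>\<open>s0\<close>, \<open>s1\<close>, \<open>s2\<close> are the parts of the exponential
  series with exponents congruent to 0, 1, 2 modulo 3. Differentiation permutes them
  cyclically.\<close>

definition s1 :: "complex \<Rightarrow> complex" where
  "s1 w = (exp w + omega' * exp (omega * w) + omega * exp (omega' * w)) / 3"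

definition s0 :: "complex \<Rightarrow> complex" where
  "s0 w = (exp w + exp (omega * w) + exp (omega' * w)) / 3"

lemma s2_has_field_derivative: "(s2 has_field_derivative s1 w) (at w within A)"
  unfolding s2_eq[abs_def] s1_def
  by (auto intro!: derivative_eq_intros simp: omega_mult omega_mult_left mult_ac)

lemma s1_has_field_derivative: "(s1 has_field_derivative s0 w) (at w within A)"
  unfolding s0_def s1_def[abs_def]
  by (auto intro!: derivative_eq_intros simp: omega_mult omega_mult_left mult_ac)

lemma s0_has_field_derivative: "(s0 has_field_derivative s2 w) (at w within A)"
  unfolding s0_def[abs_def] s2_eq
  by (auto intro!: derivative_eq_intros simp: omega_mult omega_mult_left mult_ac)

lemma s_0 [simp]: "s2 0 = 0" "s1 0 = 0" "s0 0 = 1"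
  using omega_add by (simp_all add: s2_eq s1_def s0_def add.assoc add.commute[of omega'])

lemma norm_exp_omega_le: "norm (exp (omega * w)) \<le> exp (norm w)" "norm (exp (omega' * w)) \<le> exp (norm w)"
  using norm_exp[of "omega * w"] norm_exp[of "omega' * w"] by (simp_all add: norm_mult)

lemma norm_s0_le: "norm (s0 w) \<le> exp (norm w)"
proof -
  have "norm (exp w + exp (omega * w) + exp (omega' * w)) \<le> exp (norm w) + exp (norm w) + exp (norm w)"
    by (intro norm_triangle_le add_mono norm_exp norm_exp_omega_le)
  then show ?thesis by (simp add: s0_def)
qed

text \<open>Expand all three exponentials to second order. Since 1 + \<open>omega\<close> +
  \<open>omega'\<close> = 0, the constant and linear terms cancel and the quadratic ones add up. The
  estimate is needed to fill in the kernel at \<open>l = 0\<close>.\<close>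

lemma norm_s2_Taylor: "norm (s2 w - w\<^sup>2 / 2) \<le> exp (norm w) * norm w ^ 3"
proof -
  let ?R = "\<lambda>w. exp w - (1 + w + w\<^sup>2 / 2 :: complex)"
  have R: "norm (?R w) \<le> exp (norm w) * norm w ^ 3" for w
  proof -
    have "norm (?R w) \<le> exp (norm w) * norm w ^ Suc 2 / fact 2"
      using Taylor_exp_field[of w 2] by (simp add: numeral_2_eq_2 add.assoc)
    also have "\<dots> \<le> exp (norm w) * norm w ^ 3" by (simp add: fact_numeral)
    finally show ?thesis .
  qed
  have sq: "(omega * w)\<^sup>2 = omega' * w\<^sup>2" "(omega' * w)\<^sup>2 = omega * w\<^sup>2"
    by (simp_all add: power2_eq_square omega_mult_left mult_ac)
  have s2_3: "3 * s2 w = exp w + omega * exp (omega * w) + omega' * exp (omega' * w)" by (simp add: s2_eq)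
  have "3 * s2 w - (?R w + omega * ?R (omega * w) + omega' * ?R (omega' * w))
      = (1 + (omega + omega')) + (1 + (omega * omega + omega' * omega')) * w
        + (1 + omega * omega' + omega' * omega) * w\<^sup>2 / 2"
    unfolding s2_3 sq by (simp add: algebra_simps add_divide_distrib)
  also have "\<dots> = 3 * (w\<^sup>2 / 2)" unfolding omega_mult using omega_add by (simp add: add.commute[of omega'])
  finally have "s2 w - w\<^sup>2 / 2 = (?R w + omega * ?R (omega * w) + omega' * ?R (omega' * w)) / 3"
    by (simp add: field_simps)
  also have "norm \<dots> \<le> (exp (norm w) * norm w ^ 3 + exp (norm w) * norm w ^ 3 + exp (norm w) * norm w ^ 3) / 3"
    unfolding norm_divide norm_numeral
  proof (intro divide_right_mono norm_triangle_le add_mono)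
    show "norm (omega * ?R (omega * w)) \<le> exp (norm w) * norm w ^ 3"
      "norm (omega' * ?R (omega' * w)) \<le> exp (norm w) * norm w ^ 3"
      using R[of "omega * w"] R[of "omega' * w"] by (simp_all add: norm_mult)
  qed (use R[of w] in auto)
  finally show ?thesis by simp
qed

section \<open>The kernel as a function of the difference of its arguments\<close>

definition kern :: "complex \<Rightarrow> real \<Rightarrow> complex" where
  "kern l z = (if l = 0 then of_real (z\<^sup>2 / 2) else s2 (\<i> * l * of_real z) / (\<i> * l)\<^sup>2)"

text \<open>\<open>kern1\<close> and \<open>kern0\<close> are the first and second derivatives of \<open>kern\<close> in \<open>z\<close>; at \<open>l = 0\<close>, where division
  by zero would yield zero, \<open>kern\<close> and \<open>kern1\<close> are given by their limits.\<close>

definition kern1 :: "complex \<Rightarrow> real \<Rightarrow> complex" where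
  "kern1 l z = (if l = 0 then of_real z else s1 (\<i> * l * of_real z) / (\<i> * l))"

definition kern0 :: "complex \<Rightarrow> real \<Rightarrow> complex" where
  "kern0 l z = s0 (\<i> * l * of_real z)"

lemma K1_eq_kern: "K1 l x t = kern l (x - t)"
  by (simp add: K1_def kern_def)

lemma kern_at_0 [simp]: "kern l 0 = 0" "kern1 l 0 = 0" "kern0 l 0 = 1"
  by (auto simp: kern_def kern1_def kern0_def)

lemma has_vector_derivative_compose_line:
  assumes "\<And>w. (f has_field_derivative f' w) (at w)"
  shows "((\<lambda>z. f (m * complex_of_real z)) has_vector_derivative f' (m * of_real z) * m) (at z)"
proof (rule has_vector_derivative_real_field)
  show "((\<lambda>w. f (m * w)) has_field_derivative f' (m * of_real z) * m) (at (complex_of_real z))"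
    using DERIV_chain2[OF assms, of "\<lambda>w. m * w" m "of_real z" UNIV] by (auto intro!: derivative_eq_intros)
qed

lemma kern_has_vector_derivative: "(kern l has_vector_derivative kern1 l z) (at z)"
proof (cases "l = 0")
  case True
  have "((\<lambda>z. complex_of_real (z\<^sup>2 / 2)) has_vector_derivative of_real z) (at z)"
    by (rule has_vector_derivative_of_real) (auto intro!: derivative_eq_intros)
  then show ?thesis using True by (simp add: kern_def[abs_def] kern1_def)
next
  case False
  have "((\<lambda>z. s2 (\<i> * l * of_real z) / (\<i> * l)\<^sup>2) has_vector_derivative s1 (\<i> * l * of_real z) * (\<i> * l) / (\<i> * l)\<^sup>2) (at z)"
    by (intro has_vector_derivative_divide has_vector_derivative_compose_line s2_has_field_derivative)
  then show ?thesis using False by (simp add: kern_def[abs_def] kern1_def power2_eq_square)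
qed

lemma kern1_has_vector_derivative: "(kern1 l has_vector_derivative kern0 l z) (at z)"
proof (cases "l = 0")
  case True
  have "((\<lambda>z. complex_of_real z) has_vector_derivative of_real 1) (at z)"
    by (rule has_vector_derivative_of_real) (auto intro!: derivative_eq_intros)
  then show ?thesis using True by (simp add: kern1_def[abs_def] kern0_def)
next
  case False
  have "((\<lambda>z. s1 (\<i> * l * of_real z) / (\<i> * l)) has_vector_derivative s0 (\<i> * l * of_real z) * (\<i> * l) / (\<i> * l)) (at z)"
    by (intro has_vector_derivative_divide has_vector_derivative_compose_line s1_has_field_derivative)
  then show ?thesis using False by (simp add: kern1_def[abs_def] kern0_def)
qed

lemma kern0_has_vector_derivative: "(kern0 l has_vector_derivative (\<i> * l) ^ 3 * kern l z) (at z)"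
proof -
  have "(kern0 l has_vector_derivative s2 (\<i> * l * of_real z) * (\<i> * l)) (at z)"
    unfolding kern0_def[abs_def] by (intro has_vector_derivative_compose_line s0_has_field_derivative)
  moreover have "s2 (\<i> * l * of_real z) * (\<i> * l) = (\<i> * l) ^ 3 * kern l z"
    by (auto simp: kern_def power3_eq_cube power2_eq_square)
  ultimately show ?thesis by simp
qed

lemma kern_measurable [measurable]:
  "kern l \<in> borel_measurable borel" "kern1 l \<in> borel_measurable borel" "kern0 l \<in> borel_measurable borel"
  by (rule borel_measurable_continuous_onI continuous_at_imp_continuous_on ballI has_vector_derivative_continuous[OF kern_has_vector_derivative]
      has_vector_derivative_continuous[OF kern1_has_vector_derivative] has_vector_derivative_continuous[OF kern0_has_vector_derivative])+

lemma norm_le_of_vector_derivative_le: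
  fixes f :: "real \<Rightarrow> complex"
  assumes "\<And>w. (f has_vector_derivative f' w) (at w)" and "f 0 = 0"
    and "\<And>w. \<bar>w\<bar> \<le> \<bar>z\<bar> \<Longrightarrow> norm (f' w) \<le> B"
  shows "norm (f z) \<le> B * \<bar>z\<bar>"
proof -
  have "norm (f z - f 0) \<le> B * norm (z - 0)"
  proof (rule differentiable_bound[of "{-\<bar>z\<bar>..\<bar>z\<bar>}" f "\<lambda>w h. h *\<^sub>R f' w"])
    show "(f has_derivative (\<lambda>h. h *\<^sub>R f' w)) (at w within {-\<bar>z\<bar>..\<bar>z\<bar>})" for w
      using has_vector_derivative_at_within[OF assms(1)] unfolding has_vector_derivative_def .
    show "onorm (\<lambda>h. h *\<^sub>R f' w) \<le> B" if "w \<in> {-\<bar>z\<bar>..\<bar>z\<bar>}" for w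
    proof (rule onorm_bound)
      show b: "norm (h *\<^sub>R f' w) \<le> B * norm h" for h
        using mult_left_mono[OF assms(3)[of w], of "\<bar>h\<bar>"] that by (auto simp: mult.commute)
      show "B \<ge> 0" using b[of 1] norm_ge_zero[of "f' w"] by (simp del: norm_ge_zero)
    qed
  qed auto
  then show ?thesis using assms(2) by simp
qed

text \<open>Only \<open>kern0\<close> is estimated from its formula. The other two bounds come from
  integrating from z = 0, where \<open>kern1\<close> and \<open>kern\<close> vanish; no division by
  \<open>l\<close> occurs, so they are uniform near \<open>l = 0\<close>.\<close>

lemma norm_kern_le:
  "norm (kern0 l z) \<le> exp (norm l * \<bar>z\<bar>)"
  "norm (kern1 l z) \<le> exp (norm l * \<bar>z\<bar>) * \<bar>z\<bar>"
  "norm (kern l z) \<le> exp (norm l * \<bar>z\<bar>) * \<bar>z\<bar> * \<bar>z\<bar>"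
proof -
  have 0: "norm (kern0 l z) \<le> exp (norm l * \<bar>z\<bar>)" for z
    using norm_s0_le[of "\<i> * l * of_real z"] by (simp add: kern0_def norm_mult)
  have 1: "norm (kern1 l z) \<le> exp (norm l * \<bar>z\<bar>) * \<bar>z\<bar>" for z
    by (rule norm_le_of_vector_derivative_le[OF kern1_has_vector_derivative])
      (auto intro!: order_trans[OF 0] mult_left_mono)
  show "norm (kern l z) \<le> exp (norm l * \<bar>z\<bar>) * \<bar>z\<bar> * \<bar>z\<bar>"
    by (rule norm_le_of_vector_derivative_le[OF kern_has_vector_derivative])
      (auto intro!: order_trans[OF 1] mult_mono mult_left_mono)
  show "norm (kern0 l z) \<le> exp (norm l * \<bar>z\<bar>)" "norm (kern1 l z) \<le> exp (norm l * \<bar>z\<bar>) * \<bar>z\<bar>"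
    by (rule 0 1)+
qed

text \<open>Away from 0 the kernel is a quotient of entire functions of \<open>l\<close>. At 0 the
  Taylor estimate leaves an error of order |l| |z|^3, so the singularity is removable with value z^2
  / 2.\<close>

lemma kern_holomorphic: "(\<lambda>l. kern l z) holomorphic_on A"
proof -
  have "(\<lambda>l. kern l z) holomorphic_on UNIV"
  proof (rule no_isolated_singularity'[of "{0}"])
    have "(\<lambda>l. s2 (\<i> * l * of_real z) / (\<i> * l)\<^sup>2) holomorphic_on UNIV - {0}"
      unfolding s2_eq by (intro holomorphic_intros) auto
    then show "(\<lambda>l. kern l z) holomorphic_on UNIV - {0}"
      by (rule holomorphic_transform) (auto simp: kern_def)
    have "isCont (\<lambda>l::complex. exp (norm l * \<bar>z\<bar>) * norm l * \<bar>z\<bar> ^ 3) 0"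
      by (intro continuous_intros)
    then have lim: "((\<lambda>l::complex. exp (norm l * \<bar>z\<bar>) * norm l * \<bar>z\<bar> ^ 3) \<longlongrightarrow> 0) (at 0)"
      by (simp add: isCont_def)
    have "eventually (\<lambda>l. norm (kern l z - of_real (z\<^sup>2 / 2)) \<le> exp (norm l * \<bar>z\<bar>) * norm l * \<bar>z\<bar> ^ 3) (at 0)"
      unfolding eventually_at_filter
    proof (rule always_eventually, intro allI impI)
      fix l :: complex assume l: "l \<noteq> 0"
      let ?w = "\<i> * l * of_real z"
      have "kern l z - of_real (z\<^sup>2 / 2) = (s2 ?w - ?w\<^sup>2 / 2) / (\<i> * l)\<^sup>2"
        using l by (simp add: kern_def field_simps)
      then have "norm (kern l z - of_real (z\<^sup>2 / 2)) = norm (s2 ?w - ?w\<^sup>2 / 2) / norm l ^ 2"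
        by (simp only: norm_divide norm_power norm_mult norm_ii mult_1)
      also have "\<dots> \<le> exp (norm ?w) * norm ?w ^ 3 / norm l ^ 2"
        by (intro divide_right_mono norm_s2_Taylor) simp
      also have "\<dots> = exp (norm l * \<bar>z\<bar>) * norm l * \<bar>z\<bar> ^ 3"
        using l by (simp add: norm_mult power_mult_distrib power3_eq_cube power2_eq_square)
      finally show "norm (kern l z - of_real (z\<^sup>2 / 2)) \<le> exp (norm l * \<bar>z\<bar>) * norm l * \<bar>z\<bar> ^ 3" .
    qed
    then have "((\<lambda>l. kern l z - of_real (z\<^sup>2 / 2)) \<longlongrightarrow> 0) (at 0)"
      using lim by (rule Lim_null_comparison)
    then show "((\<lambda>l. kern l z) \<longlongrightarrow> kern w z) (at w within UNIV)" if "w \<in> {0}" for w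
      using that by (simp add: LIM_zero_iff kern_def)
  qed auto
  then show ?thesis by (rule holomorphic_on_subset) simp
qed

text \<open>Numerator and denominator both pick up the factor \<open>omega'\<close>, the square of
  \<open>omega\<close>.\<close>

lemma kern_mult_omega: "kern (l * omega) z = kern l z"
proof (cases "l = 0")
  case True then show ?thesis by (simp add: kern_def)
next
  case False
  have "s2 (omega * w) = omega' * s2 w" for w
    by (simp add: s2_eq distrib_left omega_mult omega_mult_left add_ac mult.assoc[symmetric])
  from this[of "\<i> * l * of_real z"] have "s2 (\<i> * (l * omega) * of_real z) = omega' * s2 (\<i> * l * of_real z)"
    by (simp add: mult_ac)
  moreover have "(\<i> * (l * omega))\<^sup>2 = omega' * (\<i> * l)\<^sup>2"
    by (simp add: power2_eq_square omega_mult_left mult_ac)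
  moreover have "omega \<noteq> 0" "omega' \<noteq> 0" using norm_omega by force+
  ultimately show ?thesis using False by (simp add: kern_def)
qed

section \<open>The iterated kernels\<close>

text \<open>Bridges the definitions, stated with the completed measure, and the estimates and Fubini
  arguments, carried out in \<open>lborel\<close>.\<close>

lemma set_integral_lebesgue_eq_lborel:
  fixes f :: "real \<Rightarrow> complex"
  assumes [measurable]: "f \<in> borel_measurable borel" "A \<in> sets borel"
  shows "(LINT t:A|lebesgue. f t) = (LINT t:A|lborel. f t)"
    and "set_integrable lebesgue A f \<longleftrightarrow> set_integrable lborel A f"
proof -
  have m: "(\<lambda>t. indicator A t *\<^sub>R f t) \<in> borel_measurable lborel" by measurable
  show "(LINT t:A|lebesgue. f t) = (LINT t:A|lborel. f t)"
    unfolding set_lebesgue_integral_def by (rule integral_completion[OF m])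
  show "set_integrable lebesgue A f \<longleftrightarrow> set_integrable lborel A f"
    unfolding set_integrable_def by (rule integrable_completion[OF m])
qed

lemma set_integrable_lborel_bound:
  fixes f :: "real \<Rightarrow> complex" and h :: "real \<Rightarrow> real"
  assumes h: "set_integrable lborel A h" and [measurable]: "f \<in> borel_measurable borel" "A \<in> sets borel"
    and le: "\<And>t. t \<in> A \<Longrightarrow> norm (f t) \<le> h t"
  shows "set_integrable lborel A f" and "norm (LINT t:A|lborel. f t) \<le> (LINT t:A|lborel. h t)"
proof -
  have b: "norm (indicator A t *\<^sub>R f t) \<le> indicator A t *\<^sub>R h t" for t
    using le[of t] by (simp add: indicator_def)
  show "set_integrable lborel A f" unfolding set_integrable_def
  proof (rule Bochner_Integration.integrable_bound[OF h[unfolded set_integrable_def]])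
    show "AE t in lborel. norm (indicator A t *\<^sub>R f t) \<le> norm (indicator A t *\<^sub>R h t)"
      by (intro AE_I2 order_trans[OF b]) simp
  qed measurable
  show "norm (LINT t:A|lborel. f t) \<le> (LINT t:A|lborel. h t)" unfolding set_lebesgue_integral_def
    by (rule Bochner_Integration.integral_norm_bound_integral) (use \<open>set_integrable lborel A f\<close> h b in \<open>simp_all only: set_integrable_def\<close>)
qed

text \<open>The setting for the disc |l| \<le> \<open>d0\<close>: all constants below depend on
  \<open>q\<close>, \<open>d0\<close> and \<open>d\<close> but not on \<open>l\<close>, which makes
  the bounds uniform in \<open>l\<close>.\<close>

locale jost =
  fixes q :: "real \<Rightarrow> real" and d0 d :: real
  assumes q_measurable [measurable]: "q \<in> borel_measurable borel"
    and d0: "0 \<le> d0" "d0 < d"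
    and q_integrable: "integrable lborel (\<lambda>t. \<bar>q t\<bar> * exp (2 * d * \<bar>t\<bar>))"
begin

text \<open>With e = d - d0, the summands bound in turn the constants that occur for
  \<open>kern0 l z - 1\<close>, for the factor |z| in \<open>kern1\<close> and for the factor |z|^2
  in \<open>kern\<close>, each measured against \<open>exp (e * \<bar>z\<bar>)\<close>.\<close>

definition C :: real where "C = 2 + 1 / (d - d0) + 4 / (d - d0)\<^sup>2"

lemma C_ge: "C \<ge> 2" using d0 by (simp add: C_def)

lemma d_pos: "d > 0" using d0 by simp

lemma norm_kern_le_C:
  assumes l: "norm l \<le> d0"
  shows "norm (kern0 l z) \<le> C * exp (d * \<bar>z\<bar>)" "norm (kern1 l z) \<le> C * exp (d * \<bar>z\<bar>)"
    "norm (kern l z) \<le> C * exp (d * \<bar>z\<bar>)" "norm (kern0 l z - 1) \<le> C * exp (d * \<bar>z\<bar>)"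
proof -
  define e where "e = d - d0"
  let ?z = "\<bar>z\<bar>"
  have e: "e > 0" using d0 by (simp add: e_def)
  have E: "exp (norm l * ?z) \<le> exp (d0 * ?z)" using l by (simp add: mult_right_mono)
  have split: "exp (d * ?z) = exp (d0 * ?z) * exp (e * ?z)" by (simp add: e_def algebra_simps flip: exp_add)
  have "e * ?z \<le> exp (e * ?z)" using exp_ge_add_one_self[of "e * ?z"] by linarith
  then have z1: "?z \<le> 1 / e * exp (e * ?z)" using e by (simp add: field_simps)
  \<comment> \<open>Squaring the linear bound taken at half the rate restores the rate e and
    produces the constant 4 / e^2.\<close>
  have "e / 2 * ?z \<le> exp (e / 2 * ?z)" using exp_ge_add_one_self[of "e / 2 * ?z"] by linarith
  then have "(e / 2 * ?z) * (e / 2 * ?z) \<le> exp (e / 2 * ?z) * exp (e / 2 * ?z)"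
    using e by (intro mult_mono) auto
  also have "\<dots> = exp (e * ?z)" by (simp flip: exp_add)
  finally have z2: "?z * ?z \<le> 4 / e\<^sup>2 * exp (e * ?z)" using e by (simp add: field_simps power2_eq_square)
  have one: "1 \<le> exp (e * ?z)" using e by simp
  have pos: "1 / e \<ge> 0" "4 / e\<^sup>2 \<ge> 0" using e by auto
  have *: "exp (norm l * ?z) * a \<le> C * exp (d * ?z)" if "a \<le> c * exp (e * ?z)" "0 \<le> a" "c \<le> C" for a c
  proof -
    have "exp (norm l * ?z) * a \<le> exp (d0 * ?z) * (C * exp (e * ?z))"
      using that by (intro mult_mono E order_trans[OF that(1)] mult_right_mono) auto
    then show ?thesis unfolding split by (simp add: mult_ac)
  qed
  show "norm (kern0 l z) \<le> C * exp (d * ?z)"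
    using order_trans[OF norm_kern_le(1) , of l z] *[of 1 1] one pos by (simp add: C_def e_def[symmetric])
  show "norm (kern1 l z) \<le> C * exp (d * ?z)"
    by (rule order_trans[OF norm_kern_le(2)], rule *[OF z1]) (use pos in \<open>auto simp: C_def e_def[symmetric]\<close>)
  show "norm (kern l z) \<le> C * exp (d * ?z)"
    unfolding mult.assoc[symmetric]
    by (rule order_trans[OF norm_kern_le(3)], unfold mult.assoc, rule *[OF z2]) (use pos in \<open>auto simp: C_def e_def[symmetric]\<close>)
  have "1 \<le> exp (norm l * ?z)" by simp
  have "norm (kern0 l z - 1) \<le> norm (kern0 l z) + 1" using norm_triangle_ineq4[of "kern0 l z" 1] by simp
  also have "\<dots> \<le> exp (norm l * ?z) * 2"
    using norm_kern_le(1)[of l z] \<open>1 \<le> exp (norm l * ?z)\<close> by linarith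
  also have "\<dots> \<le> C * exp (d * ?z)" by (rule *[of 2 2]) (use one pos in \<open>auto simp: C_def e_def[symmetric]\<close>)
  finally show "norm (kern0 l z - 1) \<le> C * exp (d * ?z)" .
qed

lemma q_abs_integrable: "integrable lborel (\<lambda>t. \<bar>q t\<bar>)"
proof (rule Bochner_Integration.integrable_bound[OF q_integrable])
  have "\<bar>q t\<bar> * 1 \<le> \<bar>q t\<bar> * exp (2 * d * \<bar>t\<bar>)" for t
    using d_pos by (intro mult_left_mono) auto
  then show "AE t in lborel. norm \<bar>q t\<bar> \<le> norm (\<bar>q t\<bar> * exp (2 * d * \<bar>t\<bar>))" by (simp add: abs_mult)
qed measurable

definition B :: real where "B = (LINT t|lborel. \<bar>q t\<bar> * exp (2 * d * \<bar>t\<bar>))"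

definition Q :: "real \<Rightarrow> real" where "Q t = (LINT s:{..t}|lborel. \<bar>q s\<bar>)"

text \<open>The weight \<open>exp (4 * C * (Q t - Q x))\<close> at its largest, as \<open>Q\<close>
  runs between 0 and the integral of \<open>\<bar>q\<bar>\<close>.\<close>

definition M :: real where "M = C * exp (4 * C * (LINT t|lborel. \<bar>q t\<bar>))"

lemma B_nonneg: "B \<ge> 0" unfolding B_def by (rule Bochner_Integration.integral_nonneg) simp

lemma M_nonneg: "M \<ge> 0" using C_ge by (simp add: M_def)

lemma Q_bounds: "0 \<le> Q t" "Q t \<le> (LINT t|lborel. \<bar>q t\<bar>)"
proof -
  have si: "integrable lborel (\<lambda>s. indicator {..t} s *\<^sub>R \<bar>q s\<bar>)"
    by (rule integrable_mult_indicator[OF _ q_abs_integrable]) simp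
  show "0 \<le> Q t" unfolding Q_def set_lebesgue_integral_def
    by (rule Bochner_Integration.integral_nonneg) simp
  show "Q t \<le> (LINT t|lborel. \<bar>q t\<bar>)" unfolding Q_def set_lebesgue_integral_def
    by (rule integral_mono[OF si q_abs_integrable]) (simp add: indicator_def)
qed

text \<open>In the recursion the rates add up, d (s - x) + d (t - s) = d (t - x), so only the
  integral of \<open>\<bar>q s\<bar>\<close> against the weight remains. Taking k = 4 C in the
  primitive estimate bounds it by 2 / (4 C) times the weight at t; with the factor C of the new
  kernel this is 1/2. Measurability is carried along because passing to \<open>lborel\<close>
  requires it at each step.\<close>

lemma K_measurable_and_bound:
  assumes l: "norm l \<le> d0"
  shows "K q (Suc n) l x \<in> borel_measurable borel \<and>
    (\<forall>t\<ge>x. norm (K q (Suc n) l x t) \<le> C * exp (d * (t - x)) * exp (4 * C * (Q t - Q x)) / 2 ^ n) \<and>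
    (\<forall>t\<ge>x. set_integrable lborel {x..t} (\<lambda>s. K q (Suc n) l x s * of_real (q s) * K1 l s t))"
    (is "?m n \<and> (\<forall>t\<ge>x. ?b n t) \<and> (\<forall>t\<ge>x. ?i n t)")
proof -
  have step: "?i n t \<and> ?b (Suc n) t" if m [measurable]: "?m n" and b: "\<And>t. t \<ge> x \<Longrightarrow> ?b n t" and "t \<ge> x" for n t
  proof -
    let ?f = "\<lambda>s. K q (Suc n) l x s * of_real (q s) * K1 l s t"
    let ?h = "\<lambda>s. C * C * exp (d * (t - x)) * exp (- (4 * C * Q x)) / 2 ^ n * (\<bar>q s\<bar> * exp (4 * C * Q s))"
    have fm [measurable]: "?f \<in> borel_measurable borel" unfolding K1_eq_kern by measurable
    have w: "set_integrable lborel {x..t} (\<lambda>s. \<bar>q s\<bar> * exp (4 * C * Q s))"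
      "4 * C * (LINT s:{x..t}|lborel. \<bar>q s\<bar> * exp (4 * C * Q s)) \<le> 2 * (exp (4 * C * Q t) - exp (4 * C * Q x))"
      using integral_mult_exp_primitive_le[OF q_abs_integrable _ _ \<open>t \<ge> x\<close>, of "4 * C"] C_ge by (auto simp: Q_def)
    have le: "norm (?f s) \<le> ?h s" if s: "s \<in> {x..t}" for s
    proof -
      have "norm (K1 l s t) \<le> C * exp (d * (t - s))"
        using norm_kern_le_C(3)[OF l, of "s - t"] s by (simp add: K1_eq_kern)
      moreover have "norm (K q (Suc n) l x s) \<le> C * exp (d * (s - x)) * exp (4 * C * (Q s - Q x)) / 2 ^ n"
        using b[of s] s by simp
      ultimately have "norm (?f s) \<le> C * exp (d * (s - x)) * exp (4 * C * (Q s - Q x)) / 2 ^ n * \<bar>q s\<bar> * (C * exp (d * (t - s)))"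
        unfolding norm_mult using C_ge by (intro mult_mono) auto
      also have "\<dots> = C * C * (exp (d * (s - x)) * exp (d * (t - s))) * exp (4 * C * (Q s - Q x)) / 2 ^ n * \<bar>q s\<bar>"
        by simp
      also have "exp (d * (s - x)) * exp (d * (t - s)) = exp (d * (t - x))"
        by (simp add: algebra_simps flip: exp_add)
      also have "exp (4 * C * (Q s - Q x)) = exp (4 * C * Q s) * exp (- (4 * C * Q x))"
        by (simp add: algebra_simps flip: exp_add)
      finally show ?thesis by (simp add: mult_ac)
    qed
    have hi: "set_integrable lborel {x..t} ?h" by (rule set_integrable_mult_right[OF w(1)])
    note si = set_integrable_lborel_bound[OF hi fm _ le]
    have "norm (K q (Suc (Suc n)) l x t) = norm (LINT s:{x..t}|lborel. ?f s)"
      using set_integral_lebesgue_eq_lborel(1)[OF fm, of "{x..t}"] by simp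
    also have "\<dots> \<le> (LINT s:{x..t}|lborel. ?h s)" by (rule si(2)) auto
    also have "\<dots> = C * exp (d * (t - x)) * exp (- (4 * C * Q x)) / 2 ^ n / 4 * (4 * C * (LINT s:{x..t}|lborel. \<bar>q s\<bar> * exp (4 * C * Q s)))"
      by simp
    \<comment> \<open>The subtracted exponential is dropped; 2 out of 4 is the factor 1/2 for the
      next level.\<close>
    also have "\<dots> \<le> C * exp (d * (t - x)) * exp (- (4 * C * Q x)) / 2 ^ n / 4 * (2 * exp (4 * C * Q t))"
      using C_ge by (intro mult_left_mono order_trans[OF w(2)]) auto
    also have "\<dots> = C * exp (d * (t - x)) * (exp (4 * C * Q t) * exp (- (4 * C * Q x))) / 2 ^ Suc n"
      by simp
    also have "exp (4 * C * Q t) * exp (- (4 * C * Q x)) = exp (4 * C * (Q t - Q x))"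
      by (simp add: algebra_simps flip: exp_add)
    finally have "?b (Suc n) t" .
    moreover have "?i n t" by (rule si(1)) auto
    ultimately show ?thesis by blast
  qed
  have stepm: "?m (Suc n)" if [measurable]: "?m n" for n
  proof -
    \<comment> \<open>The variable t also sits in the domain of integration. Moving the domain into
      a conditional gives a jointly measurable integrand over a fixed domain.\<close>
    have "K q (Suc (Suc n)) l x t = (LINT s|lborel. (if x \<le> s \<and> s \<le> t then K q (Suc n) l x s * of_real (q s) * kern l (s - t) else 0))" for t
    proof -
      have "(\<lambda>s. K q (Suc n) l x s * of_real (q s) * K1 l s t) \<in> borel_measurable borel"
        unfolding K1_eq_kern by measurable
      from set_integral_lebesgue_eq_lborel(1)[OF this, of "{x..t}"]
      have "K q (Suc (Suc n)) l x t = (LINT s:{x..t}|lborel. K q (Suc n) l x s * of_real (q s) * K1 l s t)" by simp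
      then show ?thesis unfolding set_lebesgue_integral_def K1_eq_kern
        by (auto intro!: Bochner_Integration.integral_cong)
    qed
    then have "K q (Suc (Suc n)) l x = (\<lambda>t. LINT s|lborel. (if x \<le> s \<and> s \<le> t then K q (Suc n) l x s * of_real (q s) * kern l (s - t) else 0))"
      by (rule ext)
    moreover have "(\<lambda>t. LINT s|lborel. (if x \<le> s \<and> s \<le> t then K q (Suc n) l x s * of_real (q s) * kern l (s - t) else 0)) \<in> borel_measurable borel"
      by measurable
    ultimately show ?thesis by simp
  qed
  have "?m n \<and> (\<forall>t\<ge>x. ?b n t)"
  proof (induction n)
    case 0
    have "K q (Suc 0) l x = (\<lambda>t. kern l (x - t))" by (simp add: fun_eq_iff K1_eq_kern)
    moreover have "norm (kern l (x - t)) \<le> C * exp (d * (t - x)) * exp (4 * C * (Q t - Q x))" if "t \<ge> x" for t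
    proof -
      \<comment> \<open>Monotonicity of \<open>Q\<close> is read off from the case k = 1 of the
        estimate: its left side is nonnegative.\<close>
      have "1 * (LINT s:{x..t}|lborel. \<bar>q s\<bar> * exp (1 * Q s)) \<le> 2 * (exp (1 * Q t) - exp (1 * Q x))"
        using integral_mult_exp_primitive_le(2)[OF q_abs_integrable _ _ that, of 1] by (auto simp: Q_def)
      moreover have "0 \<le> (LINT s:{x..t}|lborel. \<bar>q s\<bar> * exp (1 * Q s))"
        unfolding set_lebesgue_integral_def by (rule Bochner_Integration.integral_nonneg) simp
      ultimately have "exp (Q x) \<le> exp (Q t)" by (simp del: exp_le_cancel_iff)
      then have "Q x \<le> Q t" by simp
      then have "1 \<le> exp (4 * C * (Q t - Q x))" using C_ge by simp
      then have "C * exp (d * (t - x)) * 1 \<le> C * exp (d * (t - x)) * exp (4 * C * (Q t - Q x))"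
        using C_ge by (intro mult_left_mono) auto
      then show ?thesis using norm_kern_le_C(3)[OF l, of "x - t"] that by simp
    qed
    ultimately show ?case by (simp del: K.simps)
  next
    case (Suc n)
    then show ?case using stepm[of n] step[of n] by blast
  qed
  then show ?thesis using step[of n] by blast
qed

lemma K_measurable [measurable (raw)]: "norm l \<le> d0 \<Longrightarrow> K q (Suc n) l x \<in> borel_measurable borel"
  using K_measurable_and_bound by blast

lemma norm_K_le:
  assumes "norm l \<le> d0" "x \<le> t"
  shows "norm (K q (Suc n) l x t) \<le> M * exp (d * (t - x)) / 2 ^ n"
proof -
  have "norm (K q (Suc n) l x t) \<le> C * exp (d * (t - x)) * exp (4 * C * (Q t - Q x)) / 2 ^ n"
    using K_measurable_and_bound[OF assms(1)] assms(2) by blast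
  also have "\<dots> \<le> C * exp (d * (t - x)) * exp (4 * C * (LINT t|lborel. \<bar>q t\<bar>)) / 2 ^ n"
    using C_ge Q_bounds[of x] Q_bounds[of t] by (intro divide_right_mono mult_left_mono) auto
  finally show ?thesis by (simp add: M_def mult_ac)
qed

end

section \<open>The Neumann series\<close>

lemma geometric_bound_sums:
  fixes a :: "nat \<Rightarrow> 'a::banach"
  assumes a: "\<And>n. norm (a n) \<le> c / 2 ^ n"
  shows "summable (\<lambda>n. norm (a n))" and "summable a" and "norm (suminf a) \<le> 2 * c"
proof -
  have g: "(\<lambda>n. c / 2 ^ n) sums (2 * c)"
    using sums_mult[OF geometric_sums[of "1/2::real"], of c] by (simp add: power_one_over mult.commute)
  show n: "summable (\<lambda>n. norm (a n))"
    by (rule summable_comparison_test'[OF sums_summable[OF g], of 0]) (use a in simp)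
  then show "summable a" by (rule summable_norm_cancel)
  have "norm (suminf a) \<le> (\<Sum>n. norm (a n))" by (rule summable_norm[OF n])
  also have "\<dots> \<le> (\<Sum>n. c / 2 ^ n)" by (rule suminf_le[OF a n sums_summable[OF g]])
  also have "\<dots> = 2 * c" by (rule sums_unique[OF g, symmetric])
  finally show "norm (suminf a) \<le> 2 * c" .
qed

text \<open>The majorant \<open>h t / 2 ^ n\<close> gives both pointwise absolute convergence and
  summable integrals of norms, the two conditions for exchanging sum and integral.\<close>

lemma set_integral_sums_geometric:
  fixes f :: "nat \<Rightarrow> real \<Rightarrow> complex"
  assumes f: "\<And>n. f n \<in> borel_measurable borel" and A: "A \<in> sets borel" and h: "set_integrable lborel A h"
    and le: "\<And>n t. t \<in> A \<Longrightarrow> norm (f n t) \<le> h t / 2 ^ n"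
  shows "(\<lambda>n. LINT t:A|lborel. f n t) sums (LINT t:A|lborel. (\<Sum>n. f n t))"
    and "set_integrable lborel A (\<lambda>t. \<Sum>n. f n t)"
proof -
  let ?g = "\<lambda>n t. indicator A t *\<^sub>R f n t"
  have b: "norm (?g n t) \<le> (indicator A t *\<^sub>R h t) / 2 ^ n" for n t
    using le[of t n] by (simp add: indicator_def)
  have hn: "set_integrable lborel A (\<lambda>t. h t / 2 ^ n)" for n
    using set_integrable_mult_right[OF h, of "1 / 2 ^ n"] by simp
  have 1: "integrable lborel (?g n)" for n
    using set_integrable_lborel_bound(1)[OF hn[of n] f A le] by (simp add: set_integrable_def)
  have 2: "summable (\<lambda>n. norm (?g n t))" for t by (rule geometric_bound_sums(1)[OF b])
  have 3: "summable (\<lambda>n. LINT t|lborel. norm (?g n t))"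
  proof (rule geometric_bound_sums(2))
    fix n
    have "integrable lborel (\<lambda>t. (indicator A t *\<^sub>R h t) / 2 ^ n)"
      using h by (simp add: set_integrable_def)
    then have "(LINT t|lborel. norm (?g n t)) \<le> (LINT t|lborel. (indicator A t *\<^sub>R h t) / 2 ^ n)"
      by (rule integral_mono[OF integrable_norm[OF 1] _ b])
    then show "norm (LINT t|lborel. norm (?g n t)) \<le> (LINT t|lborel. indicator A t *\<^sub>R h t) / 2 ^ n"
      using Bochner_Integration.integral_nonneg[of lborel "\<lambda>t. norm (?g n t)"] by simp
  qed
  have eq: "(\<Sum>n. ?g n t) = indicator A t *\<^sub>R (\<Sum>n. f n t)" for t by (simp add: indicator_def)
  show "(\<lambda>n. LINT t:A|lborel. f n t) sums (LINT t:A|lborel. (\<Sum>n. f n t))"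
    using sums_integral[OF 1 AE_I2[OF 2] 3] unfolding eq set_lebesgue_integral_def .
  show "set_integrable lborel A (\<lambda>t. \<Sum>n. f n t)"
    using integrable_suminf[OF 1 AE_I2[OF 2] 3] unfolding eq set_integrable_def .
qed

text \<open>A product of integrable functions is integrable on the plane and so can serve as
  majorant; the kernel bounds will decouple into this form.\<close>

lemma lborel_Fubini_product_bound:
  fixes H :: "real \<Rightarrow> real \<Rightarrow> complex"
  assumes H: "case_prod H \<in> borel_measurable (borel \<Otimes>\<^sub>M borel)"
    and u: "integrable lborel u" and v: "integrable lborel v"
    and le: "\<And>s t. norm (H s t) \<le> u s * v t"
  shows "(LINT t|lborel. LINT s|lborel. H s t) = (LINT s|lborel. LINT t|lborel. H s t)"
proof (rule lborel_pair.Fubini_integral)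
  have [measurable]: "u \<in> borel_measurable borel" "v \<in> borel_measurable borel" using u v by auto
  have uv: "integrable (lborel \<Otimes>\<^sub>M lborel) (\<lambda>(s, t). u s * v t)"
  proof (rule lborel_pair.Fubini_integrable)
    show "(\<lambda>(s, t). u s * v t) \<in> borel_measurable (lborel \<Otimes>\<^sub>M lborel)" by measurable
    show "AE s in lborel. integrable lborel (\<lambda>t. case (s, t) of (s, t) \<Rightarrow> u s * v t)" using v by simp
    have "integrable lborel (\<lambda>s. \<bar>u s\<bar> * (LINT t|lborel. \<bar>v t\<bar>))" using u by simp
    then show "integrable lborel (\<lambda>s. LINT t|lborel. norm (case (s, t) of (s, t) \<Rightarrow> u s * v t))"
      by (simp add: abs_mult)
  qed
  show "integrable (lborel \<Otimes>\<^sub>M lborel) (case_prod H)"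
  proof (rule Bochner_Integration.integrable_bound[OF uv])
    show "case_prod H \<in> borel_measurable (lborel \<Otimes>\<^sub>M lborel)" using H by simp
    show "AE x in lborel \<Otimes>\<^sub>M lborel. norm (case_prod H x) \<le> norm (case x of (s, t) \<Rightarrow> u s * v t)"
      by (intro AE_I2) (auto intro: order_trans[OF le])
  qed
qed

context jost
begin

text \<open>The growth class on which the operators act: it contains the plane waves and is mapped
  into itself, and its rate \<open>d\<close> together with that of the kernel is what the weight on
  \<open>q\<close> can absorb. The constant is explicit because it is summed later.\<close>

definition admissible :: "real \<Rightarrow> (real \<Rightarrow> complex) \<Rightarrow> bool" where
  "admissible D f \<longleftrightarrow> f \<in> borel_measurable borel \<and> (\<forall>t. norm (f t) \<le> D * exp (d * \<bar>t\<bar>))"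

lemma admissibleD:
  assumes "admissible D f"
  shows "f \<in> borel_measurable borel" "norm (f t) \<le> D * exp (d * \<bar>t\<bar>)" "D \<ge> 0"
  using assms norm_ge_zero[of "f 0"] by (auto simp: admissible_def dest!: spec[of _ 0] simp del: norm_ge_zero intro: order_trans)

text \<open>The index is shifted by one: \<open>T n\<close> integrates against the kernel number n +
  1 and turns out to be the power n + 1 of \<open>T 0\<close>.\<close>

definition T :: "nat \<Rightarrow> complex \<Rightarrow> (real \<Rightarrow> complex) \<Rightarrow> real \<Rightarrow> complex" where
  "T n l f x = (LINT t:{x..}|lborel. K q (Suc n) l x t * of_real (q t) * f t)"

lemma T_0: "T 0 l f x = (LINT t:{x..}|lborel. kern l (x - t) * of_real (q t) * f t)"
  by (simp add: T_def K1_eq_kern)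

lemma exp_weight_integrable: "set_integrable lborel {x..} (\<lambda>t. c * (\<bar>q t\<bar> * exp (2 * d * \<bar>t\<bar>)))"
  unfolding set_integrable_def by (rule integrable_mult_indicator) (use q_integrable in simp_all)

lemma exp_weight_integral_le: "(LINT t:{x..}|lborel. c * (\<bar>q t\<bar> * exp (2 * d * \<bar>t\<bar>))) \<le> c * B" if "c \<ge> 0"
proof -
  have "(LINT t:{x..}|lborel. c * (\<bar>q t\<bar> * exp (2 * d * \<bar>t\<bar>))) \<le> (LINT t|lborel. c * (\<bar>q t\<bar> * exp (2 * d * \<bar>t\<bar>)))"
    unfolding set_lebesgue_integral_def
    by (rule integral_mono) (use exp_weight_integrable[unfolded set_integrable_def, of x c] q_integrable that in
        \<open>auto simp: indicator_def intro!: mult_nonneg_nonneg\<close>)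
  then show ?thesis by (simp add: B_def)
qed

lemma exp_weight_shift: "exp (d * (t - x)) * exp (d * \<bar>t\<bar>) \<le> exp (- (d * x)) * exp (2 * d * \<bar>t\<bar>)"
proof -
  have "d * t \<le> d * \<bar>t\<bar>" using d_pos by simp
  then show ?thesis unfolding exp_add[symmetric] by (simp add: algebra_simps)
qed

lemma T_integrand_le:
  assumes "norm l \<le> d0" "admissible D f" "t \<in> {x..}"
  shows "norm (K q (Suc n) l x t * of_real (q t) * f t) \<le> M * D * exp (- (d * x)) * (\<bar>q t\<bar> * exp (2 * d * \<bar>t\<bar>)) / 2 ^ n"
proof -
  have "norm (K q (Suc n) l x t * of_real (q t) * f t) \<le> M * exp (d * (t - x)) / 2 ^ n * \<bar>q t\<bar> * (D * exp (d * \<bar>t\<bar>))"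
    unfolding norm_mult using norm_K_le[OF assms(1), of x t n] admissibleD[OF assms(2)] assms(3) M_nonneg
    by (intro mult_mono) auto
  also have "\<dots> = M * D * \<bar>q t\<bar> / 2 ^ n * (exp (d * (t - x)) * exp (d * \<bar>t\<bar>))" by simp
  also have "\<dots> \<le> M * D * \<bar>q t\<bar> / 2 ^ n * (exp (- (d * x)) * exp (2 * d * \<bar>t\<bar>))"
    using M_nonneg admissibleD(3)[OF assms(2)] by (intro mult_left_mono exp_weight_shift) auto
  finally show ?thesis by (simp add: mult_ac)
qed

text \<open>The factor \<open>exp (- (d * x))\<close>, sharper than the growth allowed to admissible
  functions, is what later gives the asymptotics at plus infinity.\<close>

lemma norm_T_le:
  assumes l: "norm l \<le> d0" and f: "admissible D f"
  shows "norm (T n l f x) \<le> M * D * B * exp (- (d * x)) / 2 ^ n"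
proof -
  let ?c = "M * D * exp (- (d * x)) / 2 ^ n"
  have c: "?c \<ge> 0" using M_nonneg admissibleD(3)[OF f] by simp
  have [measurable]: "f \<in> borel_measurable borel" "K q (Suc n) l x \<in> borel_measurable borel"
    using admissibleD(1)[OF f] K_measurable[OF l] by auto
  have m: "(\<lambda>t. K q (Suc n) l x t * of_real (q t) * f t) \<in> borel_measurable borel" by measurable
  have le: "norm (K q (Suc n) l x t * of_real (q t) * f t) \<le> ?c * (\<bar>q t\<bar> * exp (2 * d * \<bar>t\<bar>))" if "t \<in> {x..}" for t
    using T_integrand_le[OF l f that, of n] by simp
  have "norm (T n l f x) \<le> (LINT t:{x..}|lborel. ?c * (\<bar>q t\<bar> * exp (2 * d * \<bar>t\<bar>)))"
    unfolding T_def by (rule set_integrable_lborel_bound(2)[OF exp_weight_integrable m _ le]) auto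
  also have "\<dots> \<le> ?c * B" by (rule exp_weight_integral_le[OF c])
  finally show "norm (T n l f x) \<le> M * D * B * exp (- (d * x)) / 2 ^ n" by (simp add: mult_ac)
qed

lemma exp_minus_le_abs: "exp (- (d * x)) \<le> exp (d * \<bar>x\<bar>)"
  using d_pos abs_ge_minus_self[of "d * x"] by (simp add: abs_mult)

text \<open>Makes iteration of \<open>T 0\<close> legitimate. It is not the source of convergence,
  since M B may exceed 1; the decay in n is taken from the iterated kernels.\<close>

lemma admissible_T:
  assumes l: "norm l \<le> d0" and f: "admissible D f"
  shows "admissible (M * D * B) (T 0 l f)"
  unfolding admissible_def
proof (intro conjI allI)
  have [measurable]: "f \<in> borel_measurable borel" using admissibleD(1)[OF f] .
  have "T 0 l f = (\<lambda>x. LINT t|lborel. (if x \<le> t then kern l (x - t) * of_real (q t) * f t else 0))"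
    unfolding T_0[abs_def] set_lebesgue_integral_def by (auto intro!: ext Bochner_Integration.integral_cong)
  also have "\<dots> \<in> borel_measurable borel" by measurable
  finally show "T 0 l f \<in> borel_measurable borel" .
  fix x
  have "norm (T 0 l f x) \<le> M * D * B * exp (- (d * x))" using norm_T_le[OF assms, of 0 x] by simp
  also have "\<dots> \<le> M * D * B * exp (d * \<bar>x\<bar>)"
    using M_nonneg B_nonneg admissibleD(3)[OF f] by (intro mult_left_mono exp_minus_le_abs) auto
  finally show "norm (T 0 l f x) \<le> M * D * B * exp (d * \<bar>x\<bar>)" .
qed

text \<open>The recursion for \<open>K\<close> appends a factor at \<open>t\<close>, so Fubini peels off the innermost application of
  \<open>T 0\<close>, which acts on \<open>f\<close>.\<close>

lemma T_Suc:
  assumes l: "norm l \<le> d0" and f: "admissible D f"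
  shows "T (Suc n) l f x = T n l (T 0 l f) x"
proof -
  have [measurable]: "f \<in> borel_measurable borel" "K q (Suc n) l x \<in> borel_measurable borel"
    using admissibleD(1)[OF f] K_measurable[OF l] by auto
  \<comment> \<open>The triangle x \<le> s \<le> t is encoded in the integrand, so both orders of
    integration run over the whole line.\<close>
  define H where "H = (\<lambda>s t. if x \<le> s \<and> s \<le> t then K q (Suc n) l x s * of_real (q s) * kern l (s - t) * of_real (q t) * f t else 0)"
  have Kn: "K q (Suc (Suc n)) l x t = (LINT s:{x..t}|lborel. K q (Suc n) l x s * of_real (q s) * kern l (s - t))" for t
    using set_integral_lebesgue_eq_lborel(1)[of "\<lambda>s. K q (Suc n) l x s * of_real (q s) * kern l (s - t)" "{x..t}"]
    by (simp add: K1_eq_kern)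
  have "T (Suc n) l f x = (LINT t|lborel. LINT s|lborel. H s t)"
    unfolding T_def set_lebesgue_integral_def Kn
  proof (rule Bochner_Integration.integral_cong[OF refl])
    fix t
    show "indicator {x..} t *\<^sub>R ((LINT s|lborel. indicator {x..t} s *\<^sub>R (K q (Suc n) l x s * of_real (q s) * kern l (s - t))) * of_real (q t) * f t)
        = (LINT s|lborel. H s t)"
    proof (cases "x \<le> t")
      case True
      have "(LINT s|lborel. H s t) = (LINT s|lborel. (indicator {x..t} s *\<^sub>R (K q (Suc n) l x s * of_real (q s) * kern l (s - t))) * (of_real (q t) * f t))"
        by (rule Bochner_Integration.integral_cong) (auto simp: H_def)
      moreover have "indicator {x..} t = (1::real)" using True by simp
      ultimately show ?thesis by (simp only: integral_mult_left_zero scaleR_one mult.assoc)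
    next
      case False
      then have "H s t = 0" for s by (auto simp: H_def)
      then show ?thesis using False by simp
    qed
  qed
  also have "\<dots> = (LINT s|lborel. LINT t|lborel. H s t)"
  proof (rule lborel_Fubini_product_bound)
    show "case_prod H \<in> borel_measurable (borel \<Otimes>\<^sub>M borel)" unfolding H_def by measurable
    \<comment> \<open>No exponential weight in s is needed here: the two kernel factors telescope to
      an exponential in t - x, which goes to the majorant in t.\<close>
    show "integrable lborel (\<lambda>s. M / 2 ^ n * C * D * exp (- (d * x)) * \<bar>q s\<bar>)" using q_abs_integrable by simp
    show "integrable lborel (\<lambda>t. \<bar>q t\<bar> * exp (2 * d * \<bar>t\<bar>))" by (rule q_integrable)
    fix s t
    show "norm (H s t) \<le> M / 2 ^ n * C * D * exp (- (d * x)) * \<bar>q s\<bar> * (\<bar>q t\<bar> * exp (2 * d * \<bar>t\<bar>))"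
    proof (cases "x \<le> s \<and> s \<le> t")
      case True
      have "norm (kern l (s - t)) \<le> C * exp (d * (t - s))" using norm_kern_le_C(3)[OF l, of "s - t"] True by simp
      moreover have "H s t = K q (Suc n) l x s * of_real (q s) * kern l (s - t) * of_real (q t) * f t"
        using True by (simp add: H_def)
      ultimately have "norm (H s t) \<le> M * exp (d * (s - x)) / 2 ^ n * \<bar>q s\<bar> * (C * exp (d * (t - s))) * \<bar>q t\<bar> * (D * exp (d * \<bar>t\<bar>))"
        using norm_K_le[OF l, of x s n] admissibleD[OF f] True M_nonneg C_ge
        by (simp only: norm_mult) (intro mult_mono mult_nonneg_nonneg; simp)
      also have "\<dots> = M / 2 ^ n * C * D * \<bar>q s\<bar> * \<bar>q t\<bar> * ((exp (d * (s - x)) * exp (d * (t - s))) * exp (d * \<bar>t\<bar>))"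
        by simp
      also have "exp (d * (s - x)) * exp (d * (t - s)) = exp (d * (t - x))"
        by (simp add: algebra_simps flip: exp_add)
      also have "M / 2 ^ n * C * D * \<bar>q s\<bar> * \<bar>q t\<bar> * (exp (d * (t - x)) * exp (d * \<bar>t\<bar>))
          \<le> M / 2 ^ n * C * D * \<bar>q s\<bar> * \<bar>q t\<bar> * (exp (- (d * x)) * exp (2 * d * \<bar>t\<bar>))"
        using M_nonneg C_ge admissibleD(3)[OF f] by (intro mult_left_mono exp_weight_shift) auto
      finally show ?thesis by (simp add: mult_ac)
    next
      case False
      then show ?thesis using M_nonneg C_ge admissibleD(3)[OF f] by (auto simp: H_def)
    qed
  qed
  also have "\<dots> = T n l (T 0 l f) x"
    unfolding T_def[of n] set_lebesgue_integral_def
  proof (rule Bochner_Integration.integral_cong[OF refl])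
    fix s
    show "(LINT t|lborel. H s t) = indicator {x..} s *\<^sub>R (K q (Suc n) l x s * of_real (q s) * T 0 l f s)"
    proof (cases "x \<le> s")
      case True
      have "(LINT t|lborel. H s t) = (LINT t|lborel. (K q (Suc n) l x s * of_real (q s)) * (indicator {s..} t *\<^sub>R (kern l (s - t) * of_real (q t) * f t)))"
        by (rule Bochner_Integration.integral_cong) (use True in \<open>auto simp: H_def\<close>)
      moreover have "indicator {x..} s = (1::real)" using True by simp
      ultimately show ?thesis by (simp only: integral_mult_right_zero scaleR_one T_0 set_lebesgue_integral_def)
    next
      case False
      then have "H s t = 0" for t by (auto simp: H_def)
      then show ?thesis using False by simp
    qed
  qed
  finally show ?thesis .
qed

lemma T_eq_funpow:
  assumes l: "norm l \<le> d0" and f: "admissible D f"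
  shows "T n l f = (T 0 l ^^ Suc n) f"
  using f
proof (induction n arbitrary: D f)
  case 0 then show ?case by simp
next
  case (Suc n)
  have "T (Suc n) l f = T n l (T 0 l f)" using T_Suc[OF l Suc.prems] by (rule ext)
  \<comment> \<open>The hypothesis is used for \<open>T 0 l f\<close>, which is admissible with
    another constant; hence the induction over arbitrary \<open>D\<close> and
    \<open>f\<close>.\<close>
  also have "\<dots> = (T 0 l ^^ Suc n) (T 0 l f)" by (rule Suc.IH[OF admissible_T[OF l Suc.prems]])
  finally show ?case by (simp only: funpow_Suc_right o_apply)
qed

definition plane :: "nat \<Rightarrow> complex \<Rightarrow> real \<Rightarrow> complex" where
  "plane k l x = exp (\<i> * l * zeta k * of_real x)"

lemma admissible_plane: "norm l \<le> d0 \<Longrightarrow> admissible 1 (plane k l)"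
  unfolding admissible_def plane_def
proof (intro conjI allI)
  fix t assume l: "norm l \<le> d0"
  have "norm (exp (\<i> * l * zeta k * of_real t)) \<le> exp (norm l * \<bar>t\<bar>)"
    using norm_exp[of "\<i> * l * zeta k * of_real t"] by (simp add: norm_mult)
  also have "\<dots> \<le> exp (d * \<bar>t\<bar>)" using l d0 by (simp add: mult_right_mono)
  finally show "norm (exp (\<i> * l * zeta k * of_real t)) \<le> 1 * exp (d * \<bar>t\<bar>)" by simp
qed measurable

definition jost_term :: "nat \<Rightarrow> complex \<Rightarrow> nat \<Rightarrow> real \<Rightarrow> complex" where
  "jost_term k l n x = (- \<i>) ^ n * (T 0 l ^^ n) (plane k l) x"

lemma jost_term_0: "jost_term k l 0 = plane k l"
  by (simp add: jost_term_def fun_eq_iff)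

lemma jost_term_Suc: "jost_term k l (Suc n) x = - \<i> * T 0 l (jost_term k l n) x"
proof -
  have "T 0 l (jost_term k l n) x = (LINT t:{x..}|lborel. (- \<i>) ^ n * (kern l (x - t) * of_real (q t) * (T 0 l ^^ n) (plane k l) t))"
    unfolding T_0 jost_term_def by (simp add: mult_ac)
  then show ?thesis by (simp add: jost_term_def T_0)
qed

text \<open>Iterating \<open>admissible_T\<close> gives only the constant (M B)^n, which serves for
  measurability. The factor 2^(-n) comes from reading the term as a single integral against an
  iterated kernel. In 1 + 2 M B the 1 covers the plane wave at n = 0, and the 2 makes up for the
  index shift in \<open>T\<close>.\<close>

lemma admissible_jost_term:
  assumes l: "norm l \<le> d0"
  shows "admissible ((1 + 2 * M * B) / 2 ^ n) (jost_term k l n)"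
proof (cases n)
  case 0
  then show ?thesis using admissible_plane[OF l, of k] M_nonneg B_nonneg
    by (auto simp: jost_term_0 admissible_def intro: order_trans[OF _ mult_right_mono[of 1 "1 + 2 * M * B"]])
next
  case (Suc m)
  have adm: "admissible ((M * B) ^ n) ((T 0 l ^^ n) (plane k l))" for n
  proof (induction n)
    case 0 then show ?case using admissible_plane[OF l] by simp
  next
    case (Suc n) then show ?case using admissible_T[OF l Suc.IH] by (simp add: mult_ac)
  qed
  have [measurable]: "(T 0 l ^^ n) (plane k l) \<in> borel_measurable borel" using admissibleD(1)[OF adm] .
  have "norm (jost_term k l n x) \<le> (1 + 2 * M * B) / 2 ^ n * exp (d * \<bar>x\<bar>)" for x
  proof -
    have "norm (jost_term k l n x) = norm (T m l (plane k l) x)"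
      by (simp add: T_eq_funpow[OF l admissible_plane[OF l]] jost_term_def norm_mult norm_power Suc)
    also have "\<dots> \<le> M * B / 2 ^ m * exp (- (d * x))" using norm_T_le[OF l admissible_plane[OF l], of m k x] by simp
    also have "\<dots> \<le> M * B / 2 ^ m * exp (d * \<bar>x\<bar>)"
      using M_nonneg B_nonneg by (intro mult_left_mono exp_minus_le_abs) auto
    also have "\<dots> \<le> (1 + 2 * M * B) / 2 ^ n * exp (d * \<bar>x\<bar>)"
      by (intro mult_right_mono) (auto simp: Suc field_simps)
    finally show ?thesis .
  qed
  then show ?thesis unfolding admissible_def by (auto simp: jost_term_def[abs_def])
qed

lemma summable_N:
  assumes l: "norm l \<le> d0" and "x \<le> t"
  shows "summable (\<lambda>n. (- \<i>) ^ Suc n * K q (Suc n) l x t)"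
proof (rule geometric_bound_sums(2))
  show "norm ((- \<i>) ^ Suc n * K q (Suc n) l x t) \<le> M * exp (d * (t - x)) / 2 ^ n" for n
    using norm_K_le[OF assms, of n] by (simp add: norm_mult norm_power del: K.simps)
qed

lemma N_measurable: "norm l \<le> d0 \<Longrightarrow> N q l x \<in> borel_measurable borel"
proof -
  assume l: "norm l \<le> d0"
  have [measurable]: "K q (Suc n) l x \<in> borel_measurable borel" for n by (rule K_measurable[OF l])
  show ?thesis unfolding N_def[abs_def] by measurable
qed

lemma
  assumes l: "norm l \<le> d0"
  shows jost_formula_converges: "jost_formula_converges q k l"
    and jost_v_sums: "(\<lambda>n. jost_term k l n x) sums jost_v q k l x"
proof -
  note pl = admissible_plane[OF l, of k]
  have [measurable]: "N q l x \<in> borel_measurable borel" "plane k l \<in> borel_measurable borel"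
    "K q (Suc n) l x \<in> borel_measurable borel" for n x
    using N_measurable[OF l] admissibleD(1)[OF pl] K_measurable[OF l] by auto
  \<comment> \<open>The series is rewritten only for x \<le> t, where its convergence has been
    established; the integrals look at no other t.\<close>
  have eqN: "(\<Sum>n. (- \<i>) ^ Suc n * (K q (Suc n) l x t * of_real (q t) * plane k l t)) = N q l x t * of_real (q t) * plane k l t"
    if "x \<le> t" for x t
    unfolding N_def suminf_mult2[OF summable_N[OF l that]] suminf_mult2[OF summable_mult2[OF summable_N[OF l that]]]
    by (simp only: mult.assoc)
  have h: "set_integrable lborel {x..} (\<lambda>t. M * 1 * exp (- (d * x)) * (\<bar>q t\<bar> * exp (2 * d * \<bar>t\<bar>)))" for x
    by (rule exp_weight_integrable)
  have le: "norm ((- \<i>) ^ Suc n * (K q (Suc n) l x t * of_real (q t) * plane k l t))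
      \<le> M * 1 * exp (- (d * x)) * (\<bar>q t\<bar> * exp (2 * d * \<bar>t\<bar>)) / 2 ^ n" if "t \<in> {x..}" for n x t
    using T_integrand_le[OF l pl that, of n] by (simp add: norm_mult norm_power del: K.simps)
  have m: "(\<lambda>t. (- \<i>) ^ Suc n * (K q (Suc n) l x t * of_real (q t) * plane k l t)) \<in> borel_measurable borel" for n x
    by measurable
  note S = set_integral_sums_geometric[OF m _ h le]
  have int: "set_integrable lborel {x..} (\<lambda>t. N q l x t * of_real (q t) * plane k l t)" for x
    using S(2)[of x] eqN[of x] by (subst set_integrable_cong[OF refl]) (auto simp del: K.simps)
  show "jost_formula_converges q k l"
    unfolding jost_formula_converges_def
  proof (intro conjI allI impI)
    fix x t :: real and n :: nat assume "x \<le> t \<and> 1 \<le> n"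
    then obtain m where n: "n = Suc m" and "x \<le> t" by (cases n) auto
    have "(\<lambda>s. K q (Suc m) l x s * of_real (q s) * K1 l s t) \<in> borel_measurable borel"
      unfolding K1_eq_kern by measurable
    then show "set_integrable lebesgue {x..t} (\<lambda>s. K q n l x s * of_real (q s) * K1 l s t)"
      unfolding n using K_measurable_and_bound[OF l, of m x] \<open>x \<le> t\<close> set_integral_lebesgue_eq_lborel(2) by simp
  next
    fix x
    have "(\<lambda>t. N q l x t * of_real (q t) * plane k l t) \<in> borel_measurable borel" by measurable
    then show "set_integrable lebesgue {x..} (\<lambda>t. N q l x t * of_real (q t) * exp (\<i> * l * zeta k * of_real t))"
      using set_integral_lebesgue_eq_lborel(2) int[of x] by (simp add: plane_def)
  qed (use summable_N[OF l] in blast)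
  have "(LINT t:{x..}|lebesgue. N q l x t * of_real (q t) * plane k l t) = (LINT t:{x..}|lborel. N q l x t * of_real (q t) * plane k l t)"
    by (rule set_integral_lebesgue_eq_lborel(1)) measurable
  also have "\<dots> = (LINT t:{x..}|lborel. (\<Sum>n. (- \<i>) ^ Suc n * (K q (Suc n) l x t * of_real (q t) * plane k l t)))"
    by (rule set_lebesgue_integral_cong) (use eqN in auto)
  finally have v: "jost_v q k l x = plane k l x + (LINT t:{x..}|lborel. (\<Sum>n. (- \<i>) ^ Suc n * (K q (Suc n) l x t * of_real (q t) * plane k l t)))"
    by (simp add: jost_v_def plane_def)
  have "(LINT t:{x..}|lborel. (- \<i>) ^ Suc n * (K q (Suc n) l x t * of_real (q t) * plane k l t)) = jost_term k l (Suc n) x" for n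
    unfolding jost_term_def T_eq_funpow[OF l pl, symmetric] T_def by (rule set_integral_mult_right)
  then have "(\<lambda>n. jost_term k l (Suc n) x) sums (LINT t:{x..}|lborel. (\<Sum>n. (- \<i>) ^ Suc n * (K q (Suc n) l x t * of_real (q t) * plane k l t)))"
    using S(1)[of x] by (simp del: K.simps)
  from sums_Suc[OF this] show "(\<lambda>n. jost_term k l n x) sums jost_v q k l x"
    unfolding v by (simp add: jost_term_0 add.commute)
qed

text \<open>Applying -i \<open>T 0\<close> to the Neumann series shifts it by one term, which is the
  integral equation. The factors 2^(-n) in the admissibility constants permit integrating the series
  term by term.\<close>

lemma
  assumes l: "norm l \<le> d0"
  shows admissible_jost_v: "admissible (2 * (1 + 2 * M * B)) (jost_v q k l)"
    and jost_v_integral_equation: "jost_v q k l x = plane k l x - \<i> * T 0 l (jost_v q k l) x"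
proof -
  let ?D = "1 + 2 * M * B"
  note adm = admissible_jost_term[OF l, of _ k]
  have v: "jost_v q k l = (\<lambda>x. \<Sum>n. jost_term k l n x)"
    using jost_v_sums[OF l] by (simp add: fun_eq_iff sums_unique)
  have [measurable]: "jost_term k l n \<in> borel_measurable borel" for n using admissibleD(1)[OF adm] .
  have b: "norm (jost_term k l n t) \<le> ?D * exp (d * \<bar>t\<bar>) / 2 ^ n" for n t
    using admissibleD(2)[OF adm[of n], of t] by simp
  show "admissible (2 * ?D) (jost_v q k l)"
    unfolding admissible_def v
  proof (intro conjI allI)
    show "norm (\<Sum>n. jost_term k l n t) \<le> 2 * ?D * exp (d * \<bar>t\<bar>)" for t
      using geometric_bound_sums(3)[OF b] by (simp only: mult.assoc)
  qed measurable
  have kle: "norm (kern l (x - t) * of_real (q t) * jost_term k l n t)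
      \<le> M * ?D * exp (- (d * x)) * (\<bar>q t\<bar> * exp (2 * d * \<bar>t\<bar>)) / 2 ^ n" if "t \<in> {x..}" for n t
    using T_integrand_le[OF l adm[of n] that, of 0] by (simp add: K1_eq_kern)
  have "(\<lambda>n. LINT t:{x..}|lborel. kern l (x - t) * of_real (q t) * jost_term k l n t)
      sums (LINT t:{x..}|lborel. (\<Sum>n. kern l (x - t) * of_real (q t) * jost_term k l n t))"
    by (rule set_integral_sums_geometric(1)[OF _ _ exp_weight_integrable kle]) measurable
  moreover have "(\<Sum>n. kern l (x - t) * of_real (q t) * jost_term k l n t) = kern l (x - t) * of_real (q t) * jost_v q k l t" for t
    unfolding v by (rule suminf_mult[OF geometric_bound_sums(2)[OF b]])
  ultimately have "(\<lambda>n. T 0 l (jost_term k l n) x) sums T 0 l (jost_v q k l) x" by (simp add: T_0)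
  then have "(\<lambda>n. - \<i> * T 0 l (jost_term k l n) x) sums (- \<i> * T 0 l (jost_v q k l) x)" by (rule sums_mult)
  then have "(\<lambda>n. jost_term k l (Suc n) x) sums (- \<i> * T 0 l (jost_v q k l) x)" unfolding jost_term_Suc .
  from sums_unique2[OF sums_Suc[OF this] jost_v_sums[OF l]]
  show "jost_v q k l x = plane k l x - \<i> * T 0 l (jost_v q k l) x" by (simp add: jost_term_0)
qed

lemma jost_v_minus_plane_tendsto_0:
  assumes l: "norm l \<le> d0"
  shows "((\<lambda>x. jost_v q k l x - plane k l x) \<longlongrightarrow> 0) at_top"
proof (rule Lim_null_comparison)
  let ?c = "M * (2 * (1 + 2 * M * B)) * B"
  have "norm (jost_v q k l x - plane k l x) \<le> ?c * exp (- (d * x))" for x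
  proof -
    have "norm (jost_v q k l x - plane k l x) = norm (T 0 l (jost_v q k l) x)"
      by (subst jost_v_integral_equation[OF l]) (simp add: norm_mult)
    then show ?thesis using norm_T_le[OF l admissible_jost_v[OF l], of 0 k x] by simp
  qed
  then show "\<forall>\<^sub>F x in at_top. norm (jost_v q k l x - plane k l x) \<le> ?c * exp (- (d * x))" by simp
  have "((\<lambda>x. exp (- (d * x))) \<longlongrightarrow> 0) at_top"
    using d_pos by (intro filterlim_compose[OF exp_at_bot] filterlim_compose[OF filterlim_uminus_at_bot_at_top]
        filterlim_tendsto_pos_mult_at_top[OF tendsto_const] filterlim_ident) auto
  then show "((\<lambda>x. ?c * exp (- (d * x))) \<longlongrightarrow> 0) at_top" by (rule tendsto_mult_right_zero)
qed

end

section \<open>The differential equation and holomorphy\<close>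

context jost
begin

lemma plane_has_vector_derivative:
  "((\<lambda>x. c * plane k l x) has_vector_derivative c * (\<i> * l * zeta k) * plane k l x) (at x)"
proof -
  have "((\<lambda>x. exp (\<i> * l * zeta k * complex_of_real x)) has_vector_derivative exp (\<i> * l * zeta k * of_real x) * (\<i> * l * zeta k)) (at x)"
    by (rule has_vector_derivative_compose_line) (rule DERIV_exp)
  from has_vector_derivative_mult_right[OF this, of c] show ?thesis
    unfolding plane_def by (simp only: mult_ac)
qed

text \<open>\<open>tail_convolution_has_vector_derivative\<close> requires a function vanishing at
  0. It applies to \<open>kern\<close> and \<open>kern1\<close>, giving two derivatives, but not to
  \<open>kern0\<close>. Writing \<open>kern0\<close> as (\<open>kern0\<close> - 1) + 1 splits the
  second derivative into a C1 part \<open>v2a\<close> and the tail integral \<open>G\<close>, which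
  is locally absolutely continuous and differentiable almost everywhere.\<close>

lemma is_solution_jost_v:
  assumes l: "norm l \<le> d0"
  shows "is_solution q l (jost_v q k l)"
proof -
  define v where "v = jost_v q k l"
  define g where "g = (\<lambda>t. complex_of_real (q t) * v t)"
  define D where "D = 2 * (1 + 2 * M * B)"
  have adm: "admissible D v" unfolding v_def D_def by (rule admissible_jost_v[OF l])
  have [measurable]: "v \<in> borel_measurable borel" by (rule admissibleD(1)[OF adm])
  have gm [measurable]: "g \<in> borel_measurable borel" unfolding g_def by measurable
  have gi: "integrable lborel (\<lambda>t. norm (g t) * exp (d * \<bar>t\<bar>))"
  proof (rule Bochner_Integration.integrable_bound)
    show "integrable lborel (\<lambda>t. D * (\<bar>q t\<bar> * exp (2 * d * \<bar>t\<bar>)))" using q_integrable by simp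
    have "norm (g t) * exp (d * \<bar>t\<bar>) \<le> D * (\<bar>q t\<bar> * exp (2 * d * \<bar>t\<bar>))" for t
    proof -
      have "norm (g t) * exp (d * \<bar>t\<bar>) \<le> \<bar>q t\<bar> * (D * exp (d * \<bar>t\<bar>)) * exp (d * \<bar>t\<bar>)"
        unfolding g_def norm_mult norm_of_real by (intro mult_right_mono mult_left_mono admissibleD(2)[OF adm]) auto
      also have "\<dots> = D * (\<bar>q t\<bar> * (exp (d * \<bar>t\<bar>) * exp (d * \<bar>t\<bar>)))" by simp
      also have "exp (d * \<bar>t\<bar>) * exp (d * \<bar>t\<bar>) = exp (2 * d * \<bar>t\<bar>)" by (simp flip: exp_add)
      finally show ?thesis .
    qed
    then show "AE t in lborel. norm (norm (g t) * exp (d * \<bar>t\<bar>)) \<le> norm (D * (\<bar>q t\<bar> * exp (2 * d * \<bar>t\<bar>)))"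
      using admissibleD(3)[OF adm] by (intro AE_I2) (simp add: abs_mult)
  qed measurable
  have g1: "integrable lborel g"
  proof (rule Bochner_Integration.integrable_bound[OF gi])
    have "norm (g t) * 1 \<le> norm (g t) * exp (d * \<bar>t\<bar>)" for t using d_pos by (intro mult_left_mono) auto
    then show "AE t in lborel. norm (g t) \<le> norm (norm (g t) * exp (d * \<bar>t\<bar>))" by simp
  qed measurable
  have dge: "d \<ge> 0" using d_pos by simp
  define H0 H1 H2 R G where "H0 = (\<lambda>x. LINT t:{x..}|lborel. kern l (x - t) * g t)"
    and "H1 = (\<lambda>x. LINT t:{x..}|lborel. kern1 l (x - t) * g t)"
    and "H2 = (\<lambda>x. LINT t:{x..}|lborel. kern0 l (x - t) * g t)"
    and "R = (\<lambda>x. LINT t:{x..}|lborel. (kern0 l (x - t) - 1) * g t)"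
    and "G = (\<lambda>x. LINT t:{x..}|lborel. - \<i> * g t)"
  note conv = tail_convolution_has_vector_derivative[OF _ _ _ _ _ dge gi gm]
  have H0: "(H0 has_vector_derivative H1 x) (at x)" for x unfolding H0_def H1_def
    by (rule conv[where C=C]) (use norm_kern_le_C[OF l] kern_has_vector_derivative in auto)
  have H1: "(H1 has_vector_derivative H2 x) (at x)" for x unfolding H1_def H2_def
    by (rule conv[where C=C]) (use norm_kern_le_C[OF l] kern1_has_vector_derivative in auto)
  have R: "(R has_vector_derivative (\<i> * l) ^ 3 * H0 x) (at x)" for x
  proof -
    \<comment> \<open>One constant has to bound both the function and its derivative, hence the sum
      of 1 and the norm of (i l)^3.\<close>
    have "(R has_vector_derivative (LINT t:{x..}|lborel. (\<i> * l) ^ 3 * kern l (x - t) * g t)) (at x)"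
      unfolding R_def
    proof (rule conv[where C="(1 + norm ((\<i> * l) ^ 3)) * C" and \<phi>="\<lambda>z. kern0 l z - 1" and \<phi>'="\<lambda>z. (\<i> * l) ^ 3 * kern l z"])
      show "((\<lambda>z. kern0 l z - 1) has_vector_derivative (\<i> * l) ^ 3 * kern l z) (at z)" for z
      proof -
        have "((\<lambda>z. kern0 l z - 1) has_vector_derivative (\<i> * l) ^ 3 * kern l z - 0) (at z)"
          by (intro has_vector_derivative_diff kern0_has_vector_derivative has_vector_derivative_const)
        then show ?thesis by simp
      qed
      show "norm (kern0 l z - 1) \<le> (1 + norm ((\<i> * l) ^ 3)) * C * exp (d * \<bar>z\<bar>)" for z
        using mult_mono[of 1 "1 + norm ((\<i> * l) ^ 3)" "norm (kern0 l z - 1)" "C * exp (d * \<bar>z\<bar>)"] norm_kern_le_C(4)[OF l, of z]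
        by (simp only: mult.assoc mult_1_left) simp
      show "norm ((\<i> * l) ^ 3 * kern l z) \<le> (1 + norm ((\<i> * l) ^ 3)) * C * exp (d * \<bar>z\<bar>)" for z
        unfolding norm_mult[of "(\<i> * l) ^ 3"] mult.assoc
        by (intro mult_mono norm_kern_le_C(3)[OF l]) auto
    qed simp_all
    moreover have "(LINT t:{x..}|lborel. (\<i> * l) ^ 3 * kern l (x - t) * g t) = (\<i> * l) ^ 3 * H0 x"
      unfolding H0_def by (simp only: mult.assoc set_integral_mult_right)
    ultimately show ?thesis by simp
  qed
  have H2: "- \<i> * H2 x = - \<i> * R x + G x" for x
  proof -
    have i1: "set_integrable lborel {x..} g"
      unfolding set_integrable_def by (rule integrable_mult_indicator[OF _ g1]) simp
    have "set_integrable lborel {x..} (\<lambda>t. (kern0 l (x - t) - 1) * g t)"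
    proof (rule set_integrable_lborel_bound(1))
      show "set_integrable lborel {x..} (\<lambda>t. C * exp (d * \<bar>x\<bar>) * (norm (g t) * exp (d * \<bar>t\<bar>)))"
        unfolding set_integrable_def by (rule integrable_mult_indicator) (use gi in simp_all)
      fix t
      have "norm (kern0 l (x - t) - 1) \<le> C * exp (d * \<bar>x - t\<bar>)" by (rule norm_kern_le_C(4)[OF l])
      also have "\<dots> \<le> C * exp (d * (\<bar>x\<bar> + \<bar>t\<bar>))"
        using C_ge d_pos by (intro mult_left_mono) (auto intro!: mult_left_mono)
      finally have "norm (kern0 l (x - t) - 1) * norm (g t) \<le> C * exp (d * (\<bar>x\<bar> + \<bar>t\<bar>)) * norm (g t)"
        by (rule mult_right_mono) simp
      then show "norm ((kern0 l (x - t) - 1) * g t) \<le> C * exp (d * \<bar>x\<bar>) * (norm (g t) * exp (d * \<bar>t\<bar>))"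
        by (simp add: norm_mult distrib_left exp_add mult_ac)
    qed measurable
    from set_integral_add(2)[OF this i1] have "H2 x = R x + (LINT t:{x..}|lborel. g t)"
      unfolding H2_def R_def by (simp add: left_diff_distrib)
    moreover have "G x = - \<i> * (LINT t:{x..}|lborel. g t)" unfolding G_def by (rule set_integral_mult_right)
    ultimately show ?thesis by (simp add: algebra_simps)
  qed
  have veq: "v x = plane k l x - \<i> * H0 x" for x
    using jost_v_integral_equation[OF l, of k x] by (simp add: v_def[symmetric] T_0 H0_def g_def mult.assoc)
  let ?m = "\<i> * l * zeta k"
  define v1 where "v1 = (\<lambda>x. ?m * plane k l x - \<i> * H1 x)"
  define v2a where "v2a = (\<lambda>x. ?m * ?m * plane k l x - \<i> * R x)"
  define v3 where "v3 = (\<lambda>x. ?m * ?m * ?m * plane k l x - \<i> * ((\<i> * l) ^ 3 * H0 x))"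
  have "((\<lambda>x. 1 * plane k l x - \<i> * H0 x) has_vector_derivative 1 * ?m * plane k l x - \<i> * H1 x) (at x)" for x
    by (intro has_vector_derivative_diff plane_has_vector_derivative has_vector_derivative_mult_right H0)
  moreover have "v = (\<lambda>x. 1 * plane k l x - \<i> * H0 x)" using veq by (simp add: fun_eq_iff)
  ultimately have d1: "(v has_vector_derivative v1 x) (at x)" for x by (simp only: v1_def mult_1_left)
  have "((\<lambda>x. ?m * plane k l x - \<i> * H1 x) has_vector_derivative ?m * ?m * plane k l x - \<i> * H2 x) (at x)" for x
    by (intro has_vector_derivative_diff plane_has_vector_derivative has_vector_derivative_mult_right H1)
  moreover have "?m * ?m * plane k l x - \<i> * H2 x = v2a x + G x" for x
    using H2[of x] by (simp add: v2a_def)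
  ultimately have d2: "(v1 has_vector_derivative v2a x + G x) (at x)" for x unfolding v1_def by simp
  have d3: "(v2a has_vector_derivative v3 x) (at x)" for x unfolding v2a_def v3_def
    by (intro has_vector_derivative_diff plane_has_vector_derivative has_vector_derivative_mult_right R)
  have "isCont v3 x" for x
  proof -
    have "isCont H0 x" "isCont (plane k l) x"
      using has_vector_derivative_continuous[OF H0] has_vector_derivative_continuous[OF plane_has_vector_derivative[of 1]] by auto
    then show ?thesis unfolding v3_def by (intro continuous_intros)
  qed
  then have "continuous_on UNIV v3" by (simp add: continuous_at_imp_continuous_on)
  then have "locally_abs_cont v2a" by (rule locally_abs_cont_C1[OF d3])
  moreover have gI: "integrable lborel (\<lambda>t. - \<i> * g t)" using g1 by simp
  then have "locally_abs_cont G" unfolding G_def by (rule locally_abs_cont_tail_integral)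
  ultimately have ac: "locally_abs_cont (\<lambda>x. v2a x + G x)" by (rule locally_abs_cont_add)
  have "AE x in lebesgue. (G has_vector_derivative - (- \<i> * g x)) (at x)"
    unfolding G_def by (rule AE_tail_integral_has_vector_derivative[OF gI])
  then have "AE x in lebesgue. \<exists>w. ((\<lambda>x. v2a x + G x) has_vector_derivative w) (at x) \<and>
      \<i> * w + of_real (q x) * v x = l ^ 3 * v x"
  proof eventually_elim
    case (elim x)
    have "((\<lambda>x. v2a x + G x) has_vector_derivative v3 x + - (- \<i> * g x)) (at x)"
      by (rule has_vector_derivative_add[OF d3 elim])
    moreover have "\<i> * (v3 x + - (- \<i> * g x)) + of_real (q x) * v x = l ^ 3 * v x"
    proof -
      \<comment> \<open>Because the cube of \<open>zeta k\<close> is 1, the plane wave satisfies the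
        same third-order equation as the kernel, so the two contributions recombine to
        \<open>v\<close>.\<close>
      have m: "?m * ?m * ?m = (\<i> * l) ^ 3"
        using zeta_cube[of k] by (simp add: power3_eq_cube mult_ac)
      have i: "\<i> * (\<i> * l) ^ 3 = l ^ 3" by (simp add: power_mult_distrib power3_eq_cube[of \<i>] mult.assoc[symmetric])
      have "v3 x = (\<i> * l) ^ 3 * v x" unfolding v3_def m veq by (simp add: algebra_simps)
      then have "\<i> * (v3 x + - (- \<i> * g x)) = (\<i> * (\<i> * l) ^ 3) * v x + (\<i> * \<i>) * g x"
        by (simp only: distrib_left mult_minus_left minus_minus mult.assoc)
      then show ?thesis unfolding i by (simp add: g_def)
    qed
    ultimately show ?case by blast
  qed
  then show ?thesis unfolding is_solution_def v_def[symmetric]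
    by (intro exI[of _ v1] exI[of _ "\<lambda>x. v2a x + G x"] conjI allI d1 d2 ac)
qed

lemma is_jost_solution_jost_v:
  assumes l: "norm l \<le> d0"
  shows "is_jost_solution q k l (jost_v q k l)"
  unfolding is_jost_solution_def
proof
  show "is_solution q l (jost_v q k l)" by (rule is_solution_jost_v[OF l])
  show "((\<lambda>x. jost_v q k l x - exp (\<i> * l * zeta k * of_real x)) \<longlongrightarrow> 0) at_top"
    using jost_v_minus_plane_tendsto_0[OF l, of k] unfolding plane_def .
qed

text \<open>The induction is over all x, as the integrand contains the previous term at every t
  \<ge> x. The constant \<open>?c\<close> is independent of \<open>l\<close>, so one integrable
  majorant serves the whole disc.\<close>

lemma jost_term_holomorphic: "(\<lambda>l. jost_term k l n x) holomorphic_on ball 0 d0"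
proof (induction n arbitrary: x)
  case 0
  show ?case by (simp add: jost_term_0 plane_def) (intro holomorphic_intros)
next
  case (Suc n)
  let ?c = "M * ((1 + 2 * M * B) / 2 ^ n) * exp (- (d * x))"
  have "(\<lambda>l. LINT t|lborel. indicator {x..} t *\<^sub>R (kern l (x - t) * of_real (q t) * jost_term k l n t)) holomorphic_on ball 0 d0"
  proof (rule holomorphic_on_integral[where h="\<lambda>t. indicator {x..} t *\<^sub>R (?c * (\<bar>q t\<bar> * exp (2 * d * \<bar>t\<bar>)))"])
    show "(\<lambda>l. indicator {x..} t *\<^sub>R (kern l (x - t) * of_real (q t) * jost_term k l n t)) holomorphic_on ball 0 d0" for t
      unfolding scaleR_conv_of_real by (intro holomorphic_intros kern_holomorphic Suc.IH)
    fix l :: complex assume "l \<in> ball 0 d0"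
    then have l: "norm l \<le> d0" by simp
    have [measurable]: "jost_term k l n \<in> borel_measurable borel" using admissibleD(1)[OF admissible_jost_term[OF l]] .
    show "(\<lambda>t. indicator {x..} t *\<^sub>R (kern l (x - t) * of_real (q t) * jost_term k l n t)) \<in> borel_measurable lborel"
      by measurable
    fix t
    show "norm (indicator {x..} t *\<^sub>R (kern l (x - t) * of_real (q t) * jost_term k l n t))
        \<le> indicator {x..} t *\<^sub>R (?c * (\<bar>q t\<bar> * exp (2 * d * \<bar>t\<bar>)))"
      using T_integrand_le[OF l admissible_jost_term[OF l], of t x 0 k n] by (simp add: indicator_def K1_eq_kern)
  qed (use exp_weight_integrable in \<open>auto simp only: set_integrable_def open_ball\<close>)
  then have "(\<lambda>l. - \<i> * T 0 l (jost_term k l n) x) holomorphic_on ball 0 d0"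
    unfolding T_0 set_lebesgue_integral_def by (rule holomorphic_on_mult[OF holomorphic_on_const])
  then show ?case unfolding jost_term_Suc .
qed

lemma jost_v_holomorphic: "(\<lambda>l. jost_v q k l x) holomorphic_on ball 0 d0"
proof (rule holomorphic_uniform_sequence[OF open_ball])
  show "(\<lambda>l. \<Sum>i<n. jost_term k l i x) holomorphic_on ball 0 d0" for n
    by (intro holomorphic_intros jost_term_holomorphic)
  let ?c = "(1 + 2 * M * B) * exp (d * \<bar>x\<bar>)"
  have "uniform_limit (ball 0 d0) (\<lambda>n l. \<Sum>i<n. jost_term k l i x) (\<lambda>l. \<Sum>i. jost_term k l i x) sequentially"
  proof (rule Weierstrass_m_test)
    show "norm (jost_term k l n x) \<le> ?c / 2 ^ n" if "l \<in> ball 0 d0" for n l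
      using admissibleD(2)[OF admissible_jost_term, of l k n x] that by simp
    show "summable (\<lambda>n. ?c / 2 ^ n)"
      by (rule geometric_bound_sums(2)[where c="\<bar>?c\<bar>"]) (simp add: abs_divide)
  qed
  moreover have "(\<Sum>i. jost_term k l i x) = jost_v q k l x" if "l \<in> ball 0 d0" for l
    using jost_v_sums[of l k x] that by (simp add: sums_iff)
  ultimately have u: "uniform_limit (ball 0 d0) (\<lambda>n l. \<Sum>i<n. jost_term k l i x) (\<lambda>l. jost_v q k l x) sequentially"
    by (subst uniform_limit_cong'[where g="\<lambda>n l. \<Sum>i<n. jost_term k l i x" and i="\<lambda>l. \<Sum>i. jost_term k l i x"]) auto
  fix l :: complex assume "l \<in> ball 0 d0"
  then obtain r where r: "r > 0" "cball l r \<subseteq> ball 0 d0" by (metis open_ball open_contains_cball)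
  then show "\<exists>r>0. cball l r \<subseteq> ball 0 d0 \<and> uniform_limit (cball l r) (\<lambda>n l. \<Sum>i<n. jost_term k l i x) (\<lambda>l. jost_v q k l x) sequentially"
    using uniform_limit_on_subset[OF u] by blast
qed

end

section \<open>Reduction to Borel potentials\<close>

text \<open>Integrability passes in both directions, so the values agree whether or not the
  integrals exist. This lets the identities for \<open>K\<close>, \<open>N\<close> and
  \<open>jost_v\<close> be read off from their definitions before any convergence is known.\<close>

lemma set_lebesgue_integral_spike:
  fixes f g :: "real \<Rightarrow> complex"
  assumes Z: "negligible Z" and eq: "\<And>x. x \<notin> Z \<Longrightarrow> f x = g x"
  shows "set_integrable lebesgue S f \<longleftrightarrow> set_integrable lebesgue S g"
    and "(LINT x:S|lebesgue. f x) = (LINT x:S|lebesgue. g x)"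
proof -
  have "set_integrable lebesgue S g" if "set_integrable lebesgue S f" "\<And>x. x \<notin> Z \<Longrightarrow> g x = f x" for f g :: "real \<Rightarrow> complex"
    by (rule absolutely_integrable_spike[OF that(1) Z]) (use that(2) in auto)
  from this[of f g] this[of g f] eq show *: "set_integrable lebesgue S f \<longleftrightarrow> set_integrable lebesgue S g"
    by auto
  show "(LINT x:S|lebesgue. f x) = (LINT x:S|lebesgue. g x)"
  proof (cases "set_integrable lebesgue S f")
    case True
    then have "(LINT x:S|lebesgue. f x) = integral S f" "(LINT x:S|lebesgue. g x) = integral S g"
      using * by (auto intro: set_lebesgue_integral_eq_integral(2))
    moreover have "integral S f = integral S g" by (rule integral_spike[OF Z]) (use eq in auto)
    ultimately show ?thesis by simp
  next
    \<comment> \<open>Neither function is integrable, and both integrals take the default value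
      0.\<close>
    case False
    then show ?thesis using * by (simp add: set_integrable_def set_lebesgue_integral_def not_integrable_integral_eq)
  qed
qed

context
  fixes q q' :: "real \<Rightarrow> real" and Z :: "real set"
  assumes Z: "negligible Z" and eq: "\<And>x. x \<notin> Z \<Longrightarrow> q x = q' x"
begin

text \<open>The potential enters only under integral signs, so equality holds at every point rather
  than almost everywhere.\<close>

lemma K_spike: "K q n l x t = K q' n l x t"
proof (induction n arbitrary: t rule: less_induct)
  case (less n)
  consider "n = 0" | "n = Suc 0" | m where "n = Suc (Suc m)" by (metis not0_implies_Suc)
  then show ?case
  proof cases
    case 3
    have "K q (Suc (Suc m)) l x t = (LINT s:{x..t}|lebesgue. K q' (Suc m) l x s * of_real (q s) * K1 l s t)"
      using less[of "Suc m"] 3 by simp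
    also have "\<dots> = (LINT s:{x..t}|lebesgue. K q' (Suc m) l x s * of_real (q' s) * K1 l s t)"
      by (rule set_lebesgue_integral_spike(2)[OF Z]) (simp add: eq)
    finally show ?thesis using 3 by simp
  qed auto
qed

lemma N_spike: "N q l x t = N q' l x t"
  by (simp add: N_def K_spike del: K.simps)

lemma jost_v_spike: "jost_v q k l x = jost_v q' k l x"
proof -
  have "(LINT t:{x..}|lebesgue. N q' l x t * of_real (q t) * exp (\<i> * l * zeta k * of_real t))
      = (LINT t:{x..}|lebesgue. N q' l x t * of_real (q' t) * exp (\<i> * l * zeta k * of_real t))"
    by (rule set_lebesgue_integral_spike(2)[OF Z]) (simp add: eq)
  then show ?thesis by (simp add: jost_v_def N_spike)
qed

lemma jost_formula_converges_spike: "jost_formula_converges q k l \<longleftrightarrow> jost_formula_converges q' k l"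
proof -
  have "set_integrable lebesgue S (\<lambda>t. F t * of_real (q t) * G t) \<longleftrightarrow> set_integrable lebesgue S (\<lambda>t. F t * of_real (q' t) * G t)"
    for S and F G :: "real \<Rightarrow> complex"
    by (rule set_lebesgue_integral_spike(1)[OF Z]) (simp add: eq)
  then show ?thesis unfolding jost_formula_converges_def N_spike K_spike by simp
qed

lemma is_solution_spike:
  assumes "is_solution q' l y"
  shows "is_solution q l y"
proof -
  have ae: "AE x in lebesgue. q x = q' x"
    using Z eq by (intro AE_I'[of Z]) (auto simp: negligible_iff_null_sets)
  obtain y' y'' where y: "\<And>x. (y has_vector_derivative y' x) (at x)"
    "\<And>x. (y' has_vector_derivative y'' x) (at x)" "locally_abs_cont y''"
    "AE x in lebesgue. \<exists>w. (y'' has_vector_derivative w) (at x) \<and> \<i> * w + of_real (q' x) * y x = l ^ 3 * y x"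
    using assms unfolding is_solution_def by blast
  from y(4) ae have "AE x in lebesgue. \<exists>w. (y'' has_vector_derivative w) (at x) \<and> \<i> * w + of_real (q x) * y x = l ^ 3 * y x"
    by eventually_elim simp
  then show ?thesis unfolding is_solution_def using y(1,2,3) by blast
qed

end

section \<open>Rotation of the spectral parameter by a cube root of unity\<close>

lemma K_mult_omega: "K q n (l * omega) x t = K q n l x t"
proof (induction n arbitrary: t rule: less_induct)
  case (less n)
  have K1: "K1 (l * omega) x t = K1 l x t" for x t
    by (simp add: K1_eq_kern kern_mult_omega)
  consider "n = 0" | "n = Suc 0" | m where "n = Suc (Suc m)" by (metis not0_implies_Suc)
  then show ?case
  proof cases
    case (3 m)
    then show ?thesis using less[of "Suc m"] by (simp add: K1)
  qed (simp_all add: K1)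
qed

text \<open>The kernels are invariant under the rotation, so it acts only on the exponents of the
  plane wave, where it moves \<open>zeta k\<close> to the next root.\<close>

lemma jost_v_mult_zeta_1:
  assumes "k \<in> {0..2}"
  shows "jost_v q k (l * zeta 1) x = jost_v q ((k + 1) mod 3) l x"
proof -
  have N: "N q (l * omega) x t = N q l x t" for x t by (simp add: N_def K_mult_omega del: K.simps)
  have e: "\<i> * (l * omega) * zeta k * c = \<i> * l * zeta ((k + 1) mod 3) * c" for c
    using omega_mult_zeta[OF assms] by (simp only: mult.assoc mult.left_commute)
  have "jost_v q k (l * omega) x = jost_v q ((k + 1) mod 3) l x"
    unfolding jost_v_def N e ..
  then show ?thesis by simp
qed

section \<open>From weighted square integrability to weighted integrability\<close>

lemma integrable_exp_minus_abs:
  fixes c :: real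
  assumes "c > 0"
  shows "integrable lborel (\<lambda>t::real. exp (- (c * \<bar>t\<bar>)))"
proof (rule Bochner_Integration.integrable_bound)
  let ?f = "\<lambda>t::real. indicator {0..} t *\<^sub>R exp (- c * t)"
  have "(\<lambda>t. exp (- c * t)) absolutely_integrable_on {0..}"
    using has_integral_exp_minus_to_infinity[OF assms, of 0] by (intro nonnegative_absolutely_integrable_1) (auto simp: has_integral_iff)
  then have f: "integrable lborel ?f"
    unfolding set_integrable_def by (subst (asm) integrable_completion) auto
  have "integrable lborel (\<lambda>t. ?f (0 + - 1 * t))" by (rule lborel_integrable_real_affine[OF f]) simp
  then show "integrable lborel (\<lambda>t. ?f t + ?f (- t))" using f by simp
  show "AE t in lborel. norm (exp (- (c * \<bar>t\<bar>))) \<le> norm (?f t + ?f (- t))"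
    by (intro AE_I2) (auto simp: indicator_def)
qed measurable

text \<open>Cauchy-Schwarz in pointwise form: factor the integrand as u v with u = |q| exp(a |x|)
  and v = exp(-(a - b) |x|), and use u v \<le> u^2 + v^2. The second square is integrable because b
  < a.\<close>

lemma integrable_mult_exp_of_square:
  fixes q :: "real \<Rightarrow> real"
  assumes [measurable]: "q \<in> borel_measurable borel" and q: "integrable lborel (\<lambda>x. \<bar>q x\<bar>\<^sup>2 * exp (2 * a * \<bar>x\<bar>))"
    and "b < a"
  shows "integrable lborel (\<lambda>x. \<bar>q x\<bar> * exp (b * \<bar>x\<bar>))"
proof (rule Bochner_Integration.integrable_bound)
  show "integrable lborel (\<lambda>x. \<bar>q x\<bar>\<^sup>2 * exp (2 * a * \<bar>x\<bar>) + exp (- (2 * (a - b) * \<bar>x\<bar>)))"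
    using q \<open>b < a\<close> by (intro Bochner_Integration.integrable_add integrable_exp_minus_abs) auto
  have "\<bar>q x\<bar> * exp (b * \<bar>x\<bar>) \<le> \<bar>q x\<bar>\<^sup>2 * exp (2 * a * \<bar>x\<bar>) + exp (- (2 * (a - b) * \<bar>x\<bar>))" for x
  proof -
    define u v where "u = \<bar>q x\<bar> * exp (a * \<bar>x\<bar>)" and "v = exp (- ((a - b) * \<bar>x\<bar>))"
    have "u * v \<le> u\<^sup>2 + v\<^sup>2"
    proof -
      have "0 \<le> u * v" by (simp add: u_def v_def)
      then show ?thesis using sum_squares_bound[of u v] by linarith
    qed
    moreover have "u * v = \<bar>q x\<bar> * exp (b * \<bar>x\<bar>)"
      unfolding u_def v_def by (simp add: mult.assoc algebra_simps flip: exp_add)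
    moreover have "u\<^sup>2 = \<bar>q x\<bar>\<^sup>2 * exp (2 * a * \<bar>x\<bar>)" "v\<^sup>2 = exp (- (2 * (a - b) * \<bar>x\<bar>))"
      unfolding u_def v_def power_mult_distrib exp_double[symmetric] by (simp_all add: mult.assoc)
    ultimately show ?thesis by simp
  qed
  then show "AE x in lborel. norm (\<bar>q x\<bar> * exp (b * \<bar>x\<bar>)) \<le> norm (\<bar>q x\<bar>\<^sup>2 * exp (2 * a * \<bar>x\<bar>) + exp (- (2 * (a - b) * \<bar>x\<bar>)))"
    by (intro AE_I2) (simp add: abs_mult)
qed measurable

theorem theorem1p1:
  fixes a :: real and q :: "real \<Rightarrow> real"
  assumes "a > 0"
    and "q \<in> borel_measurable lebesgue"
    and "integrable lebesgue (\<lambda>x. \<bar>q x\<bar>\<^sup>2 * exp (2 * a * \<bar>x\<bar>))"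
  shows "(\<forall>l\<in>ball 0 (a / 3). \<forall>k\<in>{0..2}.
            jost_formula_converges q k l \<and> is_jost_solution q k l (jost_v q k l))
       \<and> (\<forall>k\<in>{0..2}. \<forall>x. (\<lambda>l. jost_v q k l x) holomorphic_on ball 0 (a / 3))
       \<and> (\<forall>l\<in>ball 0 (a / 3). \<forall>k\<in>{0..2}. \<forall>x.
            jost_v q k (l * zeta 1) x = jost_v q ((k + 1) mod 3) l x)"
proof -
  \<comment> \<open>Fubini needs a Borel measurable potential; a change on a null set affects no integral.\<close>
  obtain q' where q'm [measurable]: "q' \<in> borel_measurable lborel" and ae: "AE x in lborel. q x = q' x"
    using completion_ex_borel_measurable_real[OF assms(2)] by blast
  define Z where "Z = {x. q x \<noteq> q' x}"
  have ae': "AE x in lebesgue. q x = q' x" using ae by (rule AE_completion)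
  then have Z: "negligible Z"
    unfolding Z_def eventually_ae_filter_negligible by (auto intro: negligible_subset)
  have eq: "q x = q' x" if "x \<notin> Z" for x using that by (simp add: Z_def)
  have m: "(\<lambda>x. \<bar>q' x\<bar>\<^sup>2 * exp (2 * a * \<bar>x\<bar>)) \<in> borel_measurable lborel" by measurable
  have "integrable lebesgue (\<lambda>x. \<bar>q' x\<bar>\<^sup>2 * exp (2 * a * \<bar>x\<bar>))"
  proof (rule integrable_cong_AE_imp[OF assms(3)])
    show "(\<lambda>x. \<bar>q' x\<bar>\<^sup>2 * exp (2 * a * \<bar>x\<bar>)) \<in> borel_measurable lebesgue"
      using m by (rule measurable_completion)
    show "AE x in lebesgue. \<bar>q x\<bar>\<^sup>2 * exp (2 * a * \<bar>x\<bar>) = \<bar>q' x\<bar>\<^sup>2 * exp (2 * a * \<bar>x\<bar>)"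
      using ae' by eventually_elim simp
  qed
  then have sq: "integrable lborel (\<lambda>x. \<bar>q' x\<bar>\<^sup>2 * exp (2 * a * \<bar>x\<bar>))"
    using integrable_completion[OF m] by simp
  \<comment> \<open>Each \<open>l\<close> gets its own rates, since \<open>C\<close> blows up as
    \<open>d\<close> approaches \<open>d0\<close>. The first inequality is strict so that
    \<open>l\<close> lies in the open disc on which holomorphy was shown.\<close>
  have J: "\<exists>d0 d. norm l < d0 \<and> jost q' d0 d" if l: "l \<in> ball 0 (a / 3)" for l :: complex
  proof -
    have "norm l < a / 3" using l by simp
    then obtain d0 where d0: "norm l < d0" "d0 < a / 3" using dense by blast
    then obtain d where d: "d0 < d" "d < a / 3" using dense by blast
    have "0 \<le> d0" using d0 norm_ge_zero[of l] by linarith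
    moreover have "2 * d < a" using d \<open>a > 0\<close> by simp
    ultimately have "jost q' d0 d"
      using d integrable_mult_exp_of_square[OF _ sq, of "2 * d"] q'm by unfold_locales simp_all
    then show ?thesis using d0 by blast
  qed
  have spike: "jost_v q k l x = jost_v q' k l x" for k l x by (rule jost_v_spike[OF Z]) (rule eq)
  have "jost_formula_converges q k l \<and> is_jost_solution q k l (jost_v q k l)" if l: "l \<in> ball 0 (a / 3)" for l k
  proof -
    obtain d0 d where "norm l < d0" and j: "jost q' d0 d" using J[OF l] by blast
    then have l0: "norm l \<le> d0" by simp
    have v: "jost_v q k l = jost_v q' k l" using spike by (simp add: fun_eq_iff)
    have "jost_formula_converges q k l"
      using jost.jost_formula_converges[OF j l0] jost_formula_converges_spike[where q=q and q'=q', OF Z eq] by simp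
    moreover have "is_jost_solution q k l (jost_v q k l)"
      using jost.is_jost_solution_jost_v[OF j l0, of k] is_solution_spike[where q=q and q'=q', OF Z eq] unfolding v is_jost_solution_def by blast
    ultimately show ?thesis ..
  qed
  \<comment> \<open>Differentiability is local, so the smaller disc belonging to each point suffices
    although no single pair of rates serves the whole disc.\<close>
  moreover have "(\<lambda>l. jost_v q k l x) holomorphic_on ball 0 (a / 3)" for k x
    unfolding holomorphic_on_def
  proof
    fix l :: complex assume "l \<in> ball 0 (a / 3)"
    then obtain d0 d where l: "norm l < d0" and j: "jost q' d0 d" using J by blast
    have "(\<lambda>l. jost_v q k l x) holomorphic_on ball 0 d0"
      using jost.jost_v_holomorphic[OF j, of k x] unfolding spike .
    then have "(\<lambda>l. jost_v q k l x) field_differentiable at l"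
      by (rule holomorphic_on_imp_differentiable_at) (use l in auto)
    then show "(\<lambda>l. jost_v q k l x) field_differentiable at l within ball 0 (a / 3)"
      by (rule field_differentiable_at_within)
  qed
  ultimately show ?thesis using jost_v_mult_zeta_1 by blast
qed

end
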